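(* $\Theta^{\mathrm{nat}}_{*,*}\subseteq\widetilde{\square^{\mathrm{nat}}_{*,*}}$ as full subcategories of bipointed strict $\omega$-categories, and $\Theta\subseteq\widetilde{\square}$ as full subcategories of strict $\omega$-categories. That is, every naturally bipointed object of $\Theta$ is a bipointed retract of some naturally bipointed cube $\square^n$, and every object of $\Theta$ is a retract, in strict $\omega$-categories, of some cube $\square^n$.
   Context: $\mathsf{sCat}_\omega$ is the 1-category of strict $\omega$-categories and strict functors. $\otimes^{\mathrm{lax}}$ is the (lax) Gray tensor product, a biclosed monoidal structure on $\mathsf{sCat}_\omega$; it is the essentially unique such structure which, on $\omega$-categories $\nu(K),\nu(L)$ associated to augmented directed complexes $K,L$ with strongly loop-free unital bases (Steiner complexes), is given by $\nu(K\otimes L)$, with $K\otimes L$ the usual tensor product of chain complexes, $d(x\otimes y)=dx\otimes y+(-1)^{|x|}x\otimes dy$, with basis the products of basis elements. Its unit is the terminal $\omega$-category $\square^0$. $\square^1=\{0\to1\}$ is the arrow category, $\square^n=(\square^1)^{\otimes^{\mathrm{lax}}n}$ is the $n$-cube, and $\square\subset\mathsf{sCat}_\omega$ is the full subcategory on the cubes. The objects of $\square^n$ are the elements of $\{0,1\}^n$; write $\vec0=(0,\dots,0)$, $\vec1=(1,\dots,1)$. Joyal's category $\Theta$ is the full subcategory of $\mathsf{sCat}_\omega$ on those objects (up to isomorphism) built recursively as follows: the terminal category $\square^0$ is in $\Theta$; and if $\theta_1,\dots,\theta_k\in\Theta$ ($k\ge0$), then so is $[k](\theta_1,\dots,\theta_k)$,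 which has objects $0,1,\dots,k$, $\mathrm{Hom}(i,j)=\theta_{i+1}\times\cdots\times\theta_j$ for $i\le j$, $\mathrm{Hom}(i,j)=\emptyset$ for $i>j$, and composition given by concatenation of tuples. Bipointed strict $\omega$-categories are strict $\omega$-categories with an ordered pair of objects, with functors preserving both points; they form $\mathsf{sCat}_{\omega,*,*}$. The natural bipointing of $\square^n$ is $(\vec0,\vec1)$; that of $\theta\in\Theta$ with object set $\{0,\dots,k\}$ is $(0,k)$. $\square^{\mathrm{nat}}_{*,*}$ and $\Theta^{\mathrm{nat}}_{*,*}$ are the full subcategories of $\mathsf{sCat}_{\omega,*,*}$ on the naturally bipointed cubes, resp. naturally bipointed objects of $\Theta$. A tilde denotes idempotent completion, realized as the full subcategory of all retracts in the ambient category ($\mathsf{sCat}_\omega$ or $\mathsf{sCat}_{\omega,*,*}$). *)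

theory Defs
  imports "HOL-Library.Poly_Mapping"
begin

section \<open>Strict omega-categories\<close>

text \<open>
  Strict \<open>\<omega>\<close>-categories in the single-sorted presentation of Street and Steiner: a cell is identified
  with the identity cells over it, so an \<open>n\<close>-cell is an element fixed by \<^term>\<open>src C n\<close>
  (equivalently by \<^term>\<open>tgt C n\<close>), and the objects are the \<open>0\<close>-cells. Every cell is required to
  be of finite dimension. \<open>ocomp C n x y\<close> is in diagrammatic order and is meaningful only if
  \<open>tgt C n x = src C n y\<close>.
\<close>

record 'a ocat =
  cells :: "'a set"
  src :: "nat \<Rightarrow> 'a \<Rightarrow> 'a"
  tgt :: "nat \<Rightarrow> 'a \<Rightarrow> 'a"
  ocomp :: "nat \<Rightarrow> 'a \<Rightarrow> 'a \<Rightarrow> 'a"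

locale strict_omega_category =
  fixes C :: "'a ocat"
  assumes src_closed: "x \<in> cells C \<Longrightarrow> src C n x \<in> cells C"
    and tgt_closed: "x \<in> cells C \<Longrightarrow> tgt C n x \<in> cells C"
    and comp_closed: "\<lbrakk>x \<in> cells C; y \<in> cells C; tgt C n x = src C n y\<rbrakk> \<Longrightarrow> ocomp C n x y \<in> cells C"
    and globular_lt:
      "\<lbrakk>x \<in> cells C; m < n\<rbrakk> \<Longrightarrow>
        src C m (src C n x) = src C m x \<and> src C m (tgt C n x) = src C m x \<and>
        tgt C m (src C n x) = tgt C m x \<and> tgt C m (tgt C n x) = tgt C m x"
    and globular_ge:
      "\<lbrakk>x \<in> cells C; n \<le> m\<rbrakk> \<Longrightarrow>
        src C m (src C n x) = src C n x \<and> src C m (tgt C n x) = tgt C n x \<and>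
        tgt C m (src C n x) = src C n x \<and> tgt C m (tgt C n x) = tgt C n x"
    and finite_dim: "x \<in> cells C \<Longrightarrow> \<exists>n. src C n x = x"
    and src_comp: "\<lbrakk>x \<in> cells C; y \<in> cells C; tgt C n x = src C n y\<rbrakk> \<Longrightarrow> src C n (ocomp C n x y) = src C n x"
    and tgt_comp: "\<lbrakk>x \<in> cells C; y \<in> cells C; tgt C n x = src C n y\<rbrakk> \<Longrightarrow> tgt C n (ocomp C n x y) = tgt C n y"
    and src_comp_lt:
      "\<lbrakk>x \<in> cells C; y \<in> cells C; tgt C m x = src C m y; m < n\<rbrakk> \<Longrightarrow>
        src C n (ocomp C m x y) = ocomp C m (src C n x) (src C n y)"
    and tgt_comp_lt:
      "\<lbrakk>x \<in> cells C; y \<in> cells C; tgt C m x = src C m y; m < n\<rbrakk> \<Longrightarrow>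
        tgt C n (ocomp C m x y) = ocomp C m (tgt C n x) (tgt C n y)"
    and comp_src: "x \<in> cells C \<Longrightarrow> ocomp C n (src C n x) x = x"
    and comp_tgt: "x \<in> cells C \<Longrightarrow> ocomp C n x (tgt C n x) = x"
    and comp_assoc:
      "\<lbrakk>x \<in> cells C; y \<in> cells C; z \<in> cells C; tgt C n x = src C n y; tgt C n y = src C n z\<rbrakk> \<Longrightarrow>
        ocomp C n (ocomp C n x y) z = ocomp C n x (ocomp C n y z)"
    and interchange:
      "\<lbrakk>x \<in> cells C; y \<in> cells C; x' \<in> cells C; y' \<in> cells C; m < n;
        tgt C n x = src C n y; tgt C n x' = src C n y'; tgt C m x = src C m x'; tgt C m y = src C m y'\<rbrakk> \<Longrightarrow>
        ocomp C m (ocomp C n x y) (ocomp C n x' y') = ocomp C n (ocomp C m x x') (ocomp C m y y')"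

definition objects :: "'a ocat \<Rightarrow> 'a set" where
  "objects C = {x \<in> cells C. src C 0 x = x}"

text \<open>Strict functors act on underlying cells; values outside \<^term>\<open>cells C\<close> are irrelevant.\<close>

definition strict_functor :: "'a ocat \<Rightarrow> 'b ocat \<Rightarrow> ('a \<Rightarrow> 'b) \<Rightarrow> bool" where
  "strict_functor C D F \<longleftrightarrow>
     strict_omega_category C \<and> strict_omega_category D \<and>
     (\<forall>x \<in> cells C. F x \<in> cells D) \<and>
     (\<forall>n. \<forall>x \<in> cells C. F (src C n x) = src D n (F x) \<and> F (tgt C n x) = tgt D n (F x)) \<and>
     (\<forall>n. \<forall>x \<in> cells C. \<forall>y \<in> cells C. tgt C n x = src C n y \<longrightarrow> F (ocomp C n x y) = ocomp D n (F x) (F y))"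

definition ocat_iso :: "'a ocat \<Rightarrow> 'b ocat \<Rightarrow> bool" where
  "ocat_iso C D \<longleftrightarrow>
     (\<exists>F G. strict_functor C D F \<and> strict_functor D C G \<and>
       (\<forall>x \<in> cells C. G (F x) = x) \<and> (\<forall>y \<in> cells D. F (G y) = y))"

definition ocat_retract :: "'a ocat \<Rightarrow> 'b ocat \<Rightarrow> bool" where
  "ocat_retract C D \<longleftrightarrow>
     (\<exists>i r. strict_functor C D i \<and> strict_functor D C r \<and> (\<forall>x \<in> cells C. r (i x) = x))"

text \<open>
  The idempotent completion of the full subcategory on a class of \<open>\<omega>\<close>-categories, given by its
  objects. Its members range over the \<open>\<omega>\<close>-categories with cells in an arbitrary type \<open>'a\<close>.
\<close>

definition idem_completion :: "'b ocat set \<Rightarrow> 'a ocat set" where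
  "idem_completion P = {C. \<exists>D \<in> P. ocat_retract C D}"


section \<open>Bipointed strict omega-categories\<close>

type_synonym 'a bp_ocat = "'a ocat \<times> 'a \<times> 'a"

definition bipointed :: "'a bp_ocat \<Rightarrow> bool" where
  "bipointed = (\<lambda>(C, a, b). strict_omega_category C \<and> a \<in> objects C \<and> b \<in> objects C)"

definition bp_functor :: "'a bp_ocat \<Rightarrow> 'b bp_ocat \<Rightarrow> ('a \<Rightarrow> 'b) \<Rightarrow> bool" where
  "bp_functor = (\<lambda>(C, a, b) (D, a', b') F.
     bipointed (C, a, b) \<and> bipointed (D, a', b') \<and> strict_functor C D F \<and> F a = a' \<and> F b = b')"

definition bp_iso :: "'a bp_ocat \<Rightarrow> 'b bp_ocat \<Rightarrow> bool" where
  "bp_iso P Q \<longleftrightarrow>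
     (\<exists>F G. bp_functor P Q F \<and> bp_functor Q P G \<and>
       (\<forall>x \<in> cells (fst P). G (F x) = x) \<and> (\<forall>y \<in> cells (fst Q). F (G y) = y))"

definition bp_retract :: "'a bp_ocat \<Rightarrow> 'b bp_ocat \<Rightarrow> bool" where
  "bp_retract P Q \<longleftrightarrow>
     (\<exists>i r. bp_functor P Q i \<and> bp_functor Q P r \<and> (\<forall>x \<in> cells (fst P). r (i x) = x))"

definition bp_idem_completion :: "'b bp_ocat set \<Rightarrow> 'a bp_ocat set" where
  "bp_idem_completion \<P> = {P. \<exists>Q \<in> \<P>. bp_retract P Q}"


section \<open>Augmented directed complexes with basis and their omega-categories\<close>

text \<open>
  In degree \<open>i\<close> the chain group is free abelian on the basis elements of degree \<open>i\<close>, and the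
  distinguished submonoid consists of the chains with nonnegative coefficients. The augmentation is
  only used in degree \<open>0\<close>.
\<close>

record 'b adc =
  basis :: "'b set"
  deg :: "'b \<Rightarrow> nat"
  bd :: "'b \<Rightarrow> ('b \<Rightarrow>\<^sub>0 int)"
  aug :: "'b \<Rightarrow> int"

definition pos_chains :: "'b adc \<Rightarrow> nat \<Rightarrow> ('b \<Rightarrow>\<^sub>0 int) set" where
  "pos_chains K i = {c. (\<forall>b \<in> Poly_Mapping.keys c. b \<in> basis K \<and> deg K b = i) \<and>
                        (\<forall>b. Poly_Mapping.lookup c b \<ge> 0)}"

definition chain_aug :: "'b adc \<Rightarrow> ('b \<Rightarrow>\<^sub>0 int) \<Rightarrow> int" where
  "chain_aug K c = (\<Sum>b \<in> Poly_Mapping.keys c. Poly_Mapping.lookup c b * aug K b)"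

text \<open>
  A cell of \<open>\<nu>(K)\<close> is a double sequence \<open>x i \<alpha>\<close> of positive chains, where \<open>\<alpha> = False\<close> stands for
  Steiner's superscript \<open>-\<close> (source side) and \<open>\<alpha> = True\<close> for \<open>+\<close> (target side).
\<close>

type_synonym 'b nu_cell = "nat \<Rightarrow> bool \<Rightarrow> ('b \<Rightarrow>\<^sub>0 int)"

definition nu_trunc :: "bool \<Rightarrow> nat \<Rightarrow> 'b nu_cell \<Rightarrow> 'b nu_cell" where
  "nu_trunc \<alpha> n x = (\<lambda>i \<beta>. if i < n then x i \<beta> else if i = n then x n \<alpha> else 0)"

definition nu :: "'b adc \<Rightarrow> 'b nu_cell ocat" where
  "nu K = \<lparr>
     cells = {x. (\<forall>i \<alpha>. x i \<alpha> \<in> pos_chains K i) \<and>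
                 (\<exists>N. \<forall>i \<ge> N. \<forall>\<alpha>. x i \<alpha> = 0) \<and>
                 (\<forall>\<alpha>. chain_aug K (x 0 \<alpha>) = 1) \<and>
                 (\<forall>i \<alpha>. frag_extend (bd K) (x (Suc i) \<alpha>) = x i True - x i False)},
     src = nu_trunc False,
     tgt = nu_trunc True,
     ocomp = (\<lambda>n x y i \<alpha>. x i \<alpha> - nu_trunc True n x i \<alpha> + y i \<alpha>)\<rparr>"

definition chain_tensor :: "('b \<Rightarrow>\<^sub>0 int) \<Rightarrow> ('c \<Rightarrow>\<^sub>0 int) \<Rightarrow> ('b \<times> 'c \<Rightarrow>\<^sub>0 int)" where
  "chain_tensor c d = frag_extend (\<lambda>x. frag_extend (\<lambda>y. frag_of (x, y)) d) c"

definition adc_tensor :: "'b adc \<Rightarrow> 'c adc \<Rightarrow> ('b \<times> 'c) adc" where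
  "adc_tensor K L = \<lparr>
     basis = basis K \<times> basis L,
     deg = (\<lambda>(x, y). deg K x + deg L y),
     bd = (\<lambda>(x, y). chain_tensor (bd K x) (frag_of y)
                   + frag_cmul ((-1) ^ deg K x) (chain_tensor (frag_of x) (bd L y))),
     aug = (\<lambda>(x, y). aug K x * aug L y)\<rparr>"

text \<open>Transport of structure along a relabelling that is injective on the basis.\<close>

definition adc_relabel :: "('b \<Rightarrow> 'c) \<Rightarrow> 'b adc \<Rightarrow> 'c adc" where
  "adc_relabel f K = (let g = the_inv_into (basis K) f in \<lparr>
     basis = f ` basis K,
     deg = (\<lambda>y. deg K (g y)),
     bd = (\<lambda>y. frag_extend (\<lambda>x. frag_of (f x)) (bd K (g y))),
     aug = (\<lambda>y. aug K (g y))\<rparr>)"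


section \<open>Cubes\<close>

datatype interval = I0 | I1 | IE

definition interval_adc :: "interval adc" where
  "interval_adc = \<lparr>
     basis = UNIV,
     deg = (\<lambda>b. if b = IE then 1 else 0),
     bd = (\<lambda>b. if b = IE then frag_of I1 - frag_of I0 else 0),
     aug = (\<lambda>b. if b = IE then 0 else 1)\<rparr>"

text \<open>
  As the Gray tensor product of Steiner complexes is \<open>\<nu>(K) \<otimes> \<nu>(L) = \<nu>(K \<otimes> L)\<close>, the \<open>n\<close>-cube is \<open>\<nu>\<close> of the
  \<open>n\<close>-fold tensor power of the complex of the interval. Its basis is relabelled at each step from
  pairs to words of length \<open>n\<close>, so that all cubes have cells in a common type; the complex of the
  \<open>0\<close>-cube is the tensor unit, generated by the empty word.
\<close>

primrec cube_adc :: "nat \<Rightarrow> interval list adc" where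
  "cube_adc 0 = \<lparr>basis = {[]}, deg = (\<lambda>_. 0), bd = (\<lambda>_. 0), aug = (\<lambda>_. 1)\<rparr>"
| "cube_adc (Suc n) = adc_relabel (\<lambda>(b, w). b # w) (adc_tensor interval_adc (cube_adc n))"

definition cube :: "nat \<Rightarrow> interval list nu_cell ocat" where
  "cube n = nu (cube_adc n)"

definition cube_vertex :: "interval list \<Rightarrow> interval list nu_cell" where
  "cube_vertex v = (\<lambda>i \<alpha>. if i = 0 then frag_of v else 0)"

definition bp_cube :: "nat \<Rightarrow> interval list nu_cell bp_ocat" where
  "bp_cube n = (cube n, cube_vertex (replicate n I0), cube_vertex (replicate n I1))"


section \<open>Joyal's category Theta\<close>

definition prod_ocat :: "'a ocat list \<Rightarrow> 'a list ocat" where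
  "prod_ocat \<theta>s = \<lparr>
     cells = listset (map cells \<theta>s),
     src = (\<lambda>n xs. map (\<lambda>(\<theta>, x). src \<theta> n x) (zip \<theta>s xs)),
     tgt = (\<lambda>n xs. map (\<lambda>(\<theta>, x). tgt \<theta> n x) (zip \<theta>s xs)),
     ocomp = (\<lambda>n xs ys. map (\<lambda>(\<theta>, x, y). ocomp \<theta> n x y) (zip \<theta>s (zip xs ys)))\<rparr>"

text \<open>
  A universal type of cells, in which \<open>[k](\<theta>\<^sub>1,\<dots>,\<theta>\<^sub>k)\<close> can be formed without changing the type:
  \<open>TCell i j xs\<close> is the cell \<open>xs\<close> of \<open>Hom(i,j) = \<theta>\<^sub>i\<^sub>+\<^sub>1 \<times> \<dots> \<times> \<theta>\<^sub>j\<close>. As \<open>Hom(i,i)\<close> is the empty product,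
  \<open>TCell i i []\<close> is the identity of the object \<open>i\<close>, hence also the object \<open>i\<close> itself.
\<close>

datatype tcell = TCell nat nat "tcell list"

definition hom_ocat :: "tcell ocat list \<Rightarrow> nat \<Rightarrow> nat \<Rightarrow> tcell list ocat" where
  "hom_ocat \<theta>s i j = prod_ocat (take (j - i) (drop i \<theta>s))"

text \<open>
  An \<open>n\<close>-cell of \<open>Hom(i,j)\<close> is an \<open>(n+1)\<close>-cell of \<open>[k](\<theta>\<^sub>1,\<dots>,\<theta>\<^sub>k)\<close>, whence the shift by one in the
  operations below.
\<close>

definition bracket :: "tcell ocat list \<Rightarrow> tcell ocat" where
  "bracket \<theta>s = \<lparr>
     cells = {TCell i j xs | i j xs. i \<le> j \<and> j \<le> length \<theta>s \<and> xs \<in> cells (hom_ocat \<theta>s i j)},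
     src = (\<lambda>n c. case c of TCell i j xs \<Rightarrow>
              (case n of 0 \<Rightarrow> TCell i i [] | Suc m \<Rightarrow> TCell i j (src (hom_ocat \<theta>s i j) m xs))),
     tgt = (\<lambda>n c. case c of TCell i j xs \<Rightarrow>
              (case n of 0 \<Rightarrow> TCell j j [] | Suc m \<Rightarrow> TCell i j (tgt (hom_ocat \<theta>s i j) m xs))),
     ocomp = (\<lambda>n c c'. case c of TCell i j xs \<Rightarrow> case c' of TCell i' j' xs' \<Rightarrow>
              (case n of 0 \<Rightarrow> TCell i j' (xs @ xs')
                       | Suc m \<Rightarrow> TCell i j (ocomp (hom_ocat \<theta>s i j) m xs xs')))\<rparr>"

text \<open>
  The closure under \<open>[k](-,\<dots>,-)\<close>; the terminal \<open>\<omega>\<close>-category is the case \<open>k = 0\<close>, which starts the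
  recursion.
\<close>

inductive_set Theta_std :: "tcell ocat set" where
  "(\<And>\<theta>. \<theta> \<in> set \<theta>s \<Longrightarrow> \<theta> \<in> Theta_std) \<Longrightarrow> bracket \<theta>s \<in> Theta_std"

text \<open>\<open>\<Theta>\<close> is closed under isomorphism, and natural bipointings are transported along isomorphisms.\<close>

definition Theta :: "'a ocat set" where
  "Theta = {C. \<exists>\<theta> \<in> Theta_std. ocat_iso C \<theta>}"

definition bp_bracket :: "tcell ocat list \<Rightarrow> tcell bp_ocat" where
  "bp_bracket \<theta>s = (bracket \<theta>s, TCell 0 0 [], TCell (length \<theta>s) (length \<theta>s) [])"

definition Theta_nat :: "'a bp_ocat set" where
  "Theta_nat = {P. \<exists>\<theta>s. set \<theta>s \<subseteq> Theta_std \<and> bp_iso P (bp_bracket \<theta>s)}"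


section \<open>Well-definedness\<close>

lemma pos_chains_0: "0 \<in> pos_chains K i"
  by (simp add: pos_chains_def)

lemma pos_chains_add: "c \<in> pos_chains K i \<Longrightarrow> d \<in> pos_chains K i \<Longrightarrow> c + d \<in> pos_chains K i"
  using keys_add[of c d] by (auto simp: pos_chains_def lookup_add)

lemma nu_comp_apply:
  assumes "nu_trunc True n x = nu_trunc False n y"
  shows "ocomp (nu K) n x y = (\<lambda>i \<alpha>. if i < n then x i \<alpha> else if i = n then (if \<alpha> then y n True else x n False) else x i \<alpha> + y i \<alpha>)"
proof (intro ext)
  fix i \<alpha>
  have *: "nu_trunc True n x i \<alpha> = nu_trunc False n y i \<alpha>" using assms by simp
  show "ocomp (nu K) n x y i \<alpha> = (if i < n then x i \<alpha> else if i = n then (if \<alpha> then y n True else x n False) else x i \<alpha> + y i \<alpha>)"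
    using * by (cases \<alpha>) (auto simp: nu_def nu_trunc_def split: if_splits)
qed

lemma nu_trunc_cell:
  assumes "x \<in> cells (nu K)" shows "nu_trunc \<alpha> n x \<in> cells (nu K)"
proof -
  have "\<exists>N. \<forall>i\<ge>N. \<forall>\<beta>. nu_trunc \<alpha> n x i \<beta> = 0"
    by (rule exI[of _ "Suc n"]) (auto simp: nu_trunc_def)
  with assms show ?thesis by (auto simp: nu_def nu_trunc_def pos_chains_0)
qed

lemma nu_comp_cell:
  assumes x: "x \<in> cells (nu K)" and y: "y \<in> cells (nu K)"
    and xy: "nu_trunc True n x = nu_trunc False n y"
  shows "ocomp (nu K) n x y \<in> cells (nu K)"
proof -
  have n: "x n True = y n False" using fun_cong[OF fun_cong[OF xy, of n], of True] by (simp add: nu_trunc_def)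
  have lt: "x i \<alpha> = y i \<alpha>" if "i < n" for i \<alpha>
    using fun_cong[OF fun_cong[OF xy, of i], of \<alpha>] that by (simp add: nu_trunc_def)
  obtain N M where N: "\<forall>i\<ge>N. \<forall>\<alpha>. x i \<alpha> = 0" and M: "\<forall>i\<ge>M. \<forall>\<alpha>. y i \<alpha> = 0"
    using x y by (auto simp: nu_def)
  let ?z = "ocomp (nu K) n x y"
  have z: "?z = (\<lambda>i \<alpha>. if i < n then x i \<alpha> else if i = n then (if \<alpha> then y n True else x n False) else x i \<alpha> + y i \<alpha>)"
    by (rule nu_comp_apply[OF xy])
  have "\<exists>N. \<forall>i\<ge>N. \<forall>\<alpha>. ?z i \<alpha> = 0"
    by (rule exI[of _ "max N M"]) (use N M in \<open>auto simp: z\<close>)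
  moreover have "?z i \<alpha> \<in> pos_chains K i" for i \<alpha>
  proof -
    have "x i \<beta> \<in> pos_chains K i" "y i \<beta> \<in> pos_chains K i" for i \<beta> using x y by (auto simp: nu_def)
    then show ?thesis by (auto simp: z pos_chains_add)
  qed
  moreover have "chain_aug K (?z 0 \<alpha>) = 1" for \<alpha>
  proof -
    have "chain_aug K (x 0 \<beta>) = 1" "chain_aug K (y 0 \<beta>) = 1" for \<beta> using x y by (auto simp: nu_def)
    then show ?thesis by (auto simp: z)
  qed
  moreover have "frag_extend (bd K) (?z (Suc i) \<alpha>) = ?z i True - ?z i False" for i \<alpha>
  proof -
    have ex: "frag_extend (bd K) (x (Suc i) \<beta>) = x i True - x i False" for \<beta> using x by (auto simp: nu_def)
    have ey: "frag_extend (bd K) (y (Suc i) \<beta>) = y i True - y i False" for \<beta> using y by (auto simp: nu_def)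
    consider "Suc i < n" | "Suc i = n" | "i = n" | "i > n" by linarith
    then show ?thesis
    proof cases
      case 2 then show ?thesis using ex ey[of True] lt[of i] by (auto simp: z)
    qed (use ex ey n in \<open>auto simp: z frag_extend_add\<close>)
  qed
  ultimately show ?thesis by (simp add: nu_def)
qed

lemma nu_strict: "strict_omega_category (nu K)"
proof
  have S: "src (nu K) = nu_trunc False" and T: "tgt (nu K) = nu_trunc True" by (auto simp: nu_def)
  note st = S T
  fix x y z x' y' :: "'a nu_cell" and m n :: nat
  show "src (nu K) n x \<in> cells (nu K)" "tgt (nu K) n x \<in> cells (nu K)" if "x \<in> cells (nu K)"
    using that by (simp_all add: st nu_trunc_cell)
  show "ocomp (nu K) n x y \<in> cells (nu K)"
    if "x \<in> cells (nu K)" "y \<in> cells (nu K)" "tgt (nu K) n x = src (nu K) n y"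
    using that nu_comp_cell unfolding st by blast
  show "src (nu K) m (src (nu K) n x) = src (nu K) m x \<and> src (nu K) m (tgt (nu K) n x) = src (nu K) m x \<and>
        tgt (nu K) m (src (nu K) n x) = tgt (nu K) m x \<and> tgt (nu K) m (tgt (nu K) n x) = tgt (nu K) m x"
    if "m < n" using that by (auto simp: st nu_trunc_def fun_eq_iff)
  show "src (nu K) m (src (nu K) n x) = src (nu K) n x \<and> src (nu K) m (tgt (nu K) n x) = tgt (nu K) n x \<and>
        tgt (nu K) m (src (nu K) n x) = src (nu K) n x \<and> tgt (nu K) m (tgt (nu K) n x) = tgt (nu K) n x"
    if "n \<le> m" using that by (auto simp: st nu_trunc_def fun_eq_iff)
  show "\<exists>n. src (nu K) n x = x" if "x \<in> cells (nu K)"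
  proof -
    have "\<exists>N. \<forall>i\<ge>N. \<forall>\<alpha>. x i \<alpha> = 0" using that by (simp add: nu_def)
    then obtain N where "\<forall>i\<ge>N. \<forall>\<alpha>. x i \<alpha> = 0" ..
    then have "src (nu K) N x = x" by (auto simp: st nu_trunc_def fun_eq_iff)
    then show ?thesis ..
  qed
  show "src (nu K) n (ocomp (nu K) n x y) = src (nu K) n x"
    and "tgt (nu K) n (ocomp (nu K) n x y) = tgt (nu K) n y" if "tgt (nu K) n x = src (nu K) n y"
  proof -
    have xy: "nu_trunc True n x = nu_trunc False n y" using that by (simp add: st)
    have lt: "x i \<alpha> = y i \<alpha>" if "i < n" for i \<alpha>
      using fun_cong[OF fun_cong[OF xy, of i], of \<alpha>] that by (simp add: nu_trunc_def)
    show "src (nu K) n (ocomp (nu K) n x y) = src (nu K) n x"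
      "tgt (nu K) n (ocomp (nu K) n x y) = tgt (nu K) n y"
      unfolding nu_comp_apply[OF xy] by (auto simp: st nu_trunc_def fun_eq_iff lt)
  qed
  show "src (nu K) n (ocomp (nu K) m x y) = ocomp (nu K) m (src (nu K) n x) (src (nu K) n y)"
    "tgt (nu K) n (ocomp (nu K) m x y) = ocomp (nu K) m (tgt (nu K) n x) (tgt (nu K) n y)"
    if "m < n"
    using that by (auto simp: nu_def nu_trunc_def fun_eq_iff)
  show "ocomp (nu K) n (src (nu K) n x) x = x" "ocomp (nu K) n x (tgt (nu K) n x) = x"
    by (auto simp: nu_def nu_trunc_def fun_eq_iff)
  show "ocomp (nu K) n (ocomp (nu K) n x y) z = ocomp (nu K) n x (ocomp (nu K) n y z)"
    by (auto simp: nu_def nu_trunc_def fun_eq_iff)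
  show "ocomp (nu K) m (ocomp (nu K) n x y) (ocomp (nu K) n x' y') = ocomp (nu K) n (ocomp (nu K) m x x') (ocomp (nu K) m y y')"
    if "m < n" "tgt (nu K) n x = src (nu K) n y" "tgt (nu K) n x' = src (nu K) n y'"
      "tgt (nu K) m x = src (nu K) m x'" "tgt (nu K) m y = src (nu K) m y'"
  proof -
    have agree: "(\<forall>i<k. \<forall>\<alpha>. u i \<alpha> = v i \<alpha>) \<and> u k True = v k False"
      if "tgt (nu K) k u = src (nu K) k v" for k u v
      using that by (auto simp: st nu_trunc_def fun_eq_iff) (metis nat_neq_iff)+
    show ?thesis
    proof (intro ext)
      fix i \<alpha>
      note ag = that(1) agree[OF that(2)] agree[OF that(3)] agree[OF that(4)] agree[OF that(5)]
      consider "i < m" | "i = m" | "m < i" "i < n" | "i = n" | "n < i" using that(1) by linarith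
      then show "ocomp (nu K) m (ocomp (nu K) n x y) (ocomp (nu K) n x' y') i \<alpha> =
        ocomp (nu K) n (ocomp (nu K) m x x') (ocomp (nu K) m y y') i \<alpha>"
        by cases (use ag in \<open>auto simp: nu_def nu_trunc_def\<close>)
    qed
  qed
qed

lemma cube_strict: "strict_omega_category (cube n)"
  by (simp add: cube_def nu_strict)

lemma cube_adc_basis: "basis (cube_adc n) = {w. length w = n}"
  by (induction n)
     (auto simp: adc_relabel_def adc_tensor_def interval_adc_def Let_def image_iff length_Suc_conv)

lemma inj_on_Cons_basis: "inj_on (\<lambda>(b, w). b # w) A"
  by (auto simp: inj_on_def)

lemma relabel_inv:
  assumes "length w = n"
  shows "the_inv_into (basis (adc_tensor interval_adc (cube_adc n))) (\<lambda>(b, w). b # w) (b # w) = (b, w)"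
  using the_inv_into_f_f[OF inj_on_Cons_basis, of "(b, w)" "basis (adc_tensor interval_adc (cube_adc n))"] assms
  by (simp add: adc_tensor_def cube_adc_basis interval_adc_def)

lemma cube_adc_deg: "length w = n \<Longrightarrow> deg (cube_adc n) w = count_list w IE"
  by (induction n arbitrary: w)
     (auto simp: length_Suc_conv adc_relabel_def Let_def relabel_inv,
      auto simp: adc_tensor_def interval_adc_def)

lemma cube_adc_aug: "length w = n \<Longrightarrow> aug (cube_adc n) w = (if IE \<in> set w then 0 else 1)"
  by (induction n arbitrary: w)
     (auto simp: length_Suc_conv adc_relabel_def Let_def relabel_inv,
      auto simp: adc_tensor_def interval_adc_def)

lemma frag_extend_frag_extend:
  "frag_extend f (frag_extend g c) = frag_extend (\<lambda>x. frag_extend f (g x)) c"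
proof (rule frag_induction[of c UNIV])
qed (auto simp: frag_extend_diff)

lemma cube_adc_bd:
  assumes "length w = n"
  shows "bd (cube_adc (Suc n)) (b # w) =
    (if b = IE then frag_of (I1 # w) - frag_of (I0 # w) else 0)
    + frag_cmul (if b = IE then -1 else 1) (frag_extend (\<lambda>v. frag_of (b # v)) (bd (cube_adc n) w))"
  using assms
  by (simp add: adc_relabel_def Let_def relabel_inv)
     (auto simp: adc_tensor_def interval_adc_def chain_tensor_def frag_extend_add frag_extend_diff
        frag_extend_cmul frag_extend_minus frag_extend_frag_extend)

lemma cube_vertex_object:
  assumes "length v = n" "IE \<notin> set v"
  shows "cube_vertex v \<in> objects (cube n)"
proof -
  have "deg (cube_adc n) v = 0" "aug (cube_adc n) v = 1"
    using assms by (simp_all add: cube_adc_deg cube_adc_aug)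
  then show ?thesis
    using assms
    by (auto simp: objects_def cube_def nu_def cube_vertex_def nu_trunc_def pos_chains_def chain_aug_def
        cube_adc_basis lookup_single when_def fun_eq_iff)
qed

lemma bipointed_bp_cube: "bipointed (bp_cube n)"
  by (simp add: bipointed_def bp_cube_def cube_strict cube_vertex_object)


lemma listset_iff: "xs \<in> listset As \<longleftrightarrow> length xs = length As \<and> (\<forall>p < length As. xs ! p \<in> As ! p)"
proof (induction As arbitrary: xs)
  case (Cons A As)
  then show ?case by (cases xs) (auto simp: set_Cons_def nth_Cons split: nat.splits)
qed auto

lemma prod_cells:
  "xs \<in> cells (prod_ocat \<theta>s) \<longleftrightarrow> length xs = length \<theta>s \<and> (\<forall>p < length \<theta>s. xs ! p \<in> cells (\<theta>s ! p))"
  by (auto simp: prod_ocat_def listset_iff)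

lemma prod_ops_length [simp]:
  "length xs = length \<theta>s \<Longrightarrow> length (src (prod_ocat \<theta>s) n xs) = length \<theta>s"
  "length xs = length \<theta>s \<Longrightarrow> length (tgt (prod_ocat \<theta>s) n xs) = length \<theta>s"
  "length xs = length \<theta>s \<Longrightarrow> length ys = length \<theta>s \<Longrightarrow> length (ocomp (prod_ocat \<theta>s) n xs ys) = length \<theta>s"
  by (simp_all add: prod_ocat_def)

lemma prod_ops_nth [simp]:
  assumes "length xs = length \<theta>s" "p < length \<theta>s"
  shows "src (prod_ocat \<theta>s) n xs ! p = src (\<theta>s ! p) n (xs ! p)"
    "tgt (prod_ocat \<theta>s) n xs ! p = tgt (\<theta>s ! p) n (xs ! p)"
    "length ys = length \<theta>s \<Longrightarrow> ocomp (prod_ocat \<theta>s) n xs ys ! p = ocomp (\<theta>s ! p) n (xs ! p) (ys ! p)"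
  using assms by (simp_all add: prod_ocat_def)

lemma (in strict_omega_category) src_mono:
  assumes "x \<in> cells C" "src C n x = x" "n \<le> m" shows "src C m x = x"
  using globular_ge[OF assms(1,3)] assms(2) by simp

lemma prod_strict:
  assumes "\<And>\<theta>. \<theta> \<in> set \<theta>s \<Longrightarrow> strict_omega_category \<theta>"
  shows "strict_omega_category (prod_ocat \<theta>s)"
proof
  let ?P = "prod_ocat \<theta>s"
  have S: "strict_omega_category (\<theta>s ! p)" if "p < length \<theta>s" for p using assms that by simp
  note ax = strict_omega_category.src_closed strict_omega_category.tgt_closed
    strict_omega_category.comp_closed strict_omega_category.globular_lt strict_omega_category.globular_ge
    strict_omega_category.src_comp strict_omega_category.tgt_comp strict_omega_category.src_comp_lt
    strict_omega_category.tgt_comp_lt strict_omega_category.comp_src strict_omega_category.comp_tgt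
  have eqD: "tgt (\<theta>s ! p) n (xs ! p) = src (\<theta>s ! p) n (ys ! p)"
    if "tgt ?P n xs = src ?P n ys" "length xs = length \<theta>s" "length ys = length \<theta>s" "p < length \<theta>s" for n xs ys p
    using arg_cong[OF that(1), of "\<lambda>zs. zs ! p"] that(2-) by simp
  fix x y z x' y' and m n :: nat
  show "src ?P n x \<in> cells ?P" "tgt ?P n x \<in> cells ?P" if "x \<in> cells ?P"
    using that S by (auto simp: prod_cells ax)
  show "ocomp ?P n x y \<in> cells ?P" if "x \<in> cells ?P" "y \<in> cells ?P" "tgt ?P n x = src ?P n y"
    using that S eqD[OF that(3)] by (auto simp: prod_cells ax)
  show "src ?P m (src ?P n x) = src ?P m x \<and> src ?P m (tgt ?P n x) = src ?P m x \<and>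
        tgt ?P m (src ?P n x) = tgt ?P m x \<and> tgt ?P m (tgt ?P n x) = tgt ?P m x"
    if "x \<in> cells ?P" "m < n"
    using that S by (auto simp: prod_cells ax intro!: nth_equalityI)
  show "src ?P m (src ?P n x) = src ?P n x \<and> src ?P m (tgt ?P n x) = tgt ?P n x \<and>
        tgt ?P m (src ?P n x) = src ?P n x \<and> tgt ?P m (tgt ?P n x) = tgt ?P n x"
    if "x \<in> cells ?P" "n \<le> m"
    using that S by (auto simp: prod_cells ax intro!: nth_equalityI)
  show "\<exists>n. src ?P n x = x" if x: "x \<in> cells ?P"
  proof -
    have "\<forall>p. \<exists>n. p < length \<theta>s \<longrightarrow> src (\<theta>s ! p) n (x ! p) = x ! p"
      using x S strict_omega_category.finite_dim by (fastforce simp: prod_cells)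
    then obtain d where d: "\<And>p. p < length \<theta>s \<Longrightarrow> src (\<theta>s ! p) (d p) (x ! p) = x ! p" by metis
    let ?N = "\<Sum>p<length \<theta>s. d p"
    have "src (\<theta>s ! p) ?N (x ! p) = x ! p" if p: "p < length \<theta>s" for p
    proof (rule strict_omega_category.src_mono[OF S[OF p] _ d[OF p]])
      show "d p \<le> ?N" using p by (intro member_le_sum) auto
    qed (use x p in \<open>auto simp: prod_cells\<close>)
    then have "src ?P ?N x = x" using x by (auto simp: prod_cells intro!: nth_equalityI)
    then show ?thesis ..
  qed
  show "src ?P n (ocomp ?P n x y) = src ?P n x" "tgt ?P n (ocomp ?P n x y) = tgt ?P n y"
    if "x \<in> cells ?P" "y \<in> cells ?P" "tgt ?P n x = src ?P n y"
    using that S eqD[OF that(3)] by (auto simp: prod_cells ax intro!: nth_equalityI)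
  show "src ?P n (ocomp ?P m x y) = ocomp ?P m (src ?P n x) (src ?P n y)"
    "tgt ?P n (ocomp ?P m x y) = ocomp ?P m (tgt ?P n x) (tgt ?P n y)"
    if "x \<in> cells ?P" "y \<in> cells ?P" "tgt ?P m x = src ?P m y" "m < n"
    using that S eqD[OF that(3)] by (auto simp: prod_cells ax intro!: nth_equalityI)
  show "ocomp ?P n (src ?P n x) x = x" "ocomp ?P n x (tgt ?P n x) = x" if "x \<in> cells ?P"
    using that S by (auto simp: prod_cells ax intro!: nth_equalityI)
  show "ocomp ?P n (ocomp ?P n x y) z = ocomp ?P n x (ocomp ?P n y z)"
    if "x \<in> cells ?P" "y \<in> cells ?P" "z \<in> cells ?P" "tgt ?P n x = src ?P n y" "tgt ?P n y = src ?P n z"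
    using that S eqD[OF that(4)] eqD[OF that(5)]
    by (auto simp: prod_cells strict_omega_category.comp_assoc intro!: nth_equalityI)
  show "ocomp ?P m (ocomp ?P n x y) (ocomp ?P n x' y') = ocomp ?P n (ocomp ?P m x x') (ocomp ?P m y y')"
    if "x \<in> cells ?P" "y \<in> cells ?P" "x' \<in> cells ?P" "y' \<in> cells ?P" "m < n"
      "tgt ?P n x = src ?P n y" "tgt ?P n x' = src ?P n y'" "tgt ?P m x = src ?P m x'" "tgt ?P m y = src ?P m y'"
    using that S eqD[OF that(6)] eqD[OF that(7)] eqD[OF that(8)] eqD[OF that(9)]
    by (auto simp: prod_cells intro!: nth_equalityI strict_omega_category.interchange)
qed

lemma prod_append:
  assumes "length xs = length A" "length xs' = length A"
  shows "src (prod_ocat (A @ B)) n (xs @ ys) = src (prod_ocat A) n xs @ src (prod_ocat B) n ys"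
    "tgt (prod_ocat (A @ B)) n (xs @ ys) = tgt (prod_ocat A) n xs @ tgt (prod_ocat B) n ys"
    "ocomp (prod_ocat (A @ B)) n (xs @ ys) (xs' @ ys') = ocomp (prod_ocat A) n xs xs' @ ocomp (prod_ocat B) n ys ys'"
    "xs @ ys \<in> cells (prod_ocat (A @ B)) \<longleftrightarrow> xs \<in> cells (prod_ocat A) \<and> ys \<in> cells (prod_ocat B)"
proof -
  show "xs @ ys \<in> cells (prod_ocat (A @ B)) \<longleftrightarrow> xs \<in> cells (prod_ocat A) \<and> ys \<in> cells (prod_ocat B)"
    using assms by (auto simp: prod_cells nth_append)
      (metis (no_types, opaque_lifting) add.commute add_diff_cancel_right' add_less_cancel_left not_add_less2)
qed (use assms in \<open>simp_all add: prod_ocat_def\<close>)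

lemma hom_slice:
  assumes "i \<le> j" "j \<le> l"
  shows "take (l - i) (drop i \<theta>s) = take (j - i) (drop i \<theta>s) @ take (l - j) (drop j \<theta>s)"
proof -
  have "l - i = (j - i) + (l - j)" using assms by simp
  then have "take (l - i) (drop i \<theta>s) = take (j - i) (drop i \<theta>s) @ take (l - j) (drop (j - i) (drop i \<theta>s))"
    by (simp only: take_add)
  then show ?thesis using assms by simp
qed

lemma hom_refl [simp]:
  "xs \<in> cells (hom_ocat \<theta>s i i) \<longleftrightarrow> xs = []" "src (hom_ocat \<theta>s i i) n [] = []" "tgt (hom_ocat \<theta>s i i) n [] = []"
  "ocomp (hom_ocat \<theta>s i i) n [] [] = []"
  by (auto simp: hom_ocat_def prod_ocat_def)

lemma hom_append:
  assumes "i \<le> j" "j \<le> l" "l \<le> length \<theta>s"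
    and "xs \<in> cells (hom_ocat \<theta>s i j)" "xs' \<in> cells (hom_ocat \<theta>s i j)"
  shows "src (hom_ocat \<theta>s i l) n (xs @ ys) = src (hom_ocat \<theta>s i j) n xs @ src (hom_ocat \<theta>s j l) n ys"
    "tgt (hom_ocat \<theta>s i l) n (xs @ ys) = tgt (hom_ocat \<theta>s i j) n xs @ tgt (hom_ocat \<theta>s j l) n ys"
    "ocomp (hom_ocat \<theta>s i l) n (xs @ ys) (xs' @ ys') =
      ocomp (hom_ocat \<theta>s i j) n xs xs' @ ocomp (hom_ocat \<theta>s j l) n ys ys'"
    "xs @ ys \<in> cells (hom_ocat \<theta>s i l) \<longleftrightarrow> ys \<in> cells (hom_ocat \<theta>s j l)"
proof -
  let ?A = "take (j - i) (drop i \<theta>s)"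
  have l: "length xs = length ?A" "length xs' = length ?A"
    using assms(4,5) unfolding hom_ocat_def prod_cells by blast+
  note * = prod_append[OF l, where B = "take (l - j) (drop j \<theta>s)", folded hom_slice[OF assms(1,2)], folded hom_ocat_def]
  show "src (hom_ocat \<theta>s i l) n (xs @ ys) = src (hom_ocat \<theta>s i j) n xs @ src (hom_ocat \<theta>s j l) n ys"
    "tgt (hom_ocat \<theta>s i l) n (xs @ ys) = tgt (hom_ocat \<theta>s i j) n xs @ tgt (hom_ocat \<theta>s j l) n ys"
    "ocomp (hom_ocat \<theta>s i l) n (xs @ ys) (xs' @ ys') =
      ocomp (hom_ocat \<theta>s i j) n xs xs' @ ocomp (hom_ocat \<theta>s j l) n ys ys'"
    "xs @ ys \<in> cells (hom_ocat \<theta>s i l) \<longleftrightarrow> ys \<in> cells (hom_ocat \<theta>s j l)"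
    using * assms(4) by auto
qed

lemma bracket_cells:
  "TCell i j xs \<in> cells (bracket \<theta>s) \<longleftrightarrow> i \<le> j \<and> j \<le> length \<theta>s \<and> xs \<in> cells (hom_ocat \<theta>s i j)"
  by (auto simp: bracket_def)

lemma bracket_ops [simp]:
  "src (bracket \<theta>s) 0 (TCell i j xs) = TCell i i []"
  "src (bracket \<theta>s) (Suc n) (TCell i j xs) = TCell i j (src (hom_ocat \<theta>s i j) n xs)"
  "tgt (bracket \<theta>s) 0 (TCell i j xs) = TCell j j []"
  "tgt (bracket \<theta>s) (Suc n) (TCell i j xs) = TCell i j (tgt (hom_ocat \<theta>s i j) n xs)"
  "ocomp (bracket \<theta>s) 0 (TCell i j xs) (TCell i' j' xs') = TCell i j' (xs @ xs')"
  "ocomp (bracket \<theta>s) (Suc n) (TCell i j xs) (TCell i' j' xs') = TCell i j (ocomp (hom_ocat \<theta>s i j) n xs xs')"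
  by (simp_all add: bracket_def)

lemma bracket_strict:
  assumes "\<And>\<theta>. \<theta> \<in> set \<theta>s \<Longrightarrow> strict_omega_category \<theta>"
  shows "strict_omega_category (bracket \<theta>s)"
proof
  let ?P = "bracket \<theta>s"
  have H: "strict_omega_category (hom_ocat \<theta>s i j)" for i j
    unfolding hom_ocat_def by (rule prod_strict) (meson assms in_set_dropD in_set_takeD)
  note ax = strict_omega_category.src_closed[OF H] strict_omega_category.tgt_closed[OF H]
    strict_omega_category.comp_closed[OF H] strict_omega_category.globular_lt[OF H]
    strict_omega_category.globular_ge[OF H]
    strict_omega_category.src_comp[OF H] strict_omega_category.tgt_comp[OF H] strict_omega_category.src_comp_lt[OF H]
    strict_omega_category.tgt_comp_lt[OF H] strict_omega_category.comp_src[OF H] strict_omega_category.comp_tgt[OF H]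
    strict_omega_category.comp_assoc[OF H] strict_omega_category.interchange[OF H]
  fix x y z x' y' and m n :: nat
  obtain xi xj xs where x: "x = TCell xi xj xs" by (cases x)
  obtain yi yj ys where y: "y = TCell yi yj ys" by (cases y)
  obtain zi zj zs where z: "z = TCell zi zj zs" by (cases z)
  obtain xi' xj' xs' where x': "x' = TCell xi' xj' xs'" by (cases x')
  obtain yi' yj' ys' where y': "y' = TCell yi' yj' ys'" by (cases y')
  note c = x y z x' y' bracket_cells
  show "src ?P n x \<in> cells ?P" "tgt ?P n x \<in> cells ?P" if "x \<in> cells ?P"
    using that by (cases n; auto simp: c ax)+
  show "ocomp ?P n x y \<in> cells ?P" if "x \<in> cells ?P" "y \<in> cells ?P" "tgt ?P n x = src ?P n y"
    using that by (cases n) (auto simp: c ax hom_append)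
  show "src ?P m (src ?P n x) = src ?P m x \<and> src ?P m (tgt ?P n x) = src ?P m x \<and>
        tgt ?P m (src ?P n x) = tgt ?P m x \<and> tgt ?P m (tgt ?P n x) = tgt ?P m x"
    if "x \<in> cells ?P" "m < n"
    using that by (cases n; cases m) (auto simp: c ax)
  show "src ?P m (src ?P n x) = src ?P n x \<and> src ?P m (tgt ?P n x) = tgt ?P n x \<and>
        tgt ?P m (src ?P n x) = src ?P n x \<and> tgt ?P m (tgt ?P n x) = tgt ?P n x"
    if "x \<in> cells ?P" "n \<le> m"
    using that by (cases n; cases m) (auto simp: c ax)
  show "\<exists>n. src ?P n x = x" if px: "x \<in> cells ?P"
  proof -
    obtain n where "src (hom_ocat \<theta>s xi xj) n xs = xs"
      using px strict_omega_category.finite_dim[OF H, of xs xi xj] by (auto simp: c)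
    then have "src ?P (Suc n) x = x" by (simp add: x)
    then show ?thesis ..
  qed
  show "src ?P n (ocomp ?P n x y) = src ?P n x" "tgt ?P n (ocomp ?P n x y) = tgt ?P n y"
    if "x \<in> cells ?P" "y \<in> cells ?P" "tgt ?P n x = src ?P n y"
    using that by (cases n; auto simp: c ax)+
  show "src ?P n (ocomp ?P m x y) = ocomp ?P m (src ?P n x) (src ?P n y)"
    "tgt ?P n (ocomp ?P m x y) = ocomp ?P m (tgt ?P n x) (tgt ?P n y)"
    if "x \<in> cells ?P" "y \<in> cells ?P" "tgt ?P m x = src ?P m y" "m < n"
    using that by (cases n; cases m; auto simp: c ax hom_append)+
  show "ocomp ?P n (src ?P n x) x = x" "ocomp ?P n x (tgt ?P n x) = x" if "x \<in> cells ?P"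
    using that by (cases n; auto simp: c ax)+
  show "ocomp ?P n (ocomp ?P n x y) z = ocomp ?P n x (ocomp ?P n y z)"
    if "x \<in> cells ?P" "y \<in> cells ?P" "z \<in> cells ?P" "tgt ?P n x = src ?P n y" "tgt ?P n y = src ?P n z"
    using that by (cases n) (auto simp: c ax)
  show "ocomp ?P m (ocomp ?P n x y) (ocomp ?P n x' y') = ocomp ?P n (ocomp ?P m x x') (ocomp ?P m y y')"
    if "x \<in> cells ?P" "y \<in> cells ?P" "x' \<in> cells ?P" "y' \<in> cells ?P" "m < n"
      "tgt ?P n x = src ?P n y" "tgt ?P n x' = src ?P n y'" "tgt ?P m x = src ?P m x'" "tgt ?P m y = src ?P m y'"
    using that by (cases n; cases m) (auto simp: c ax hom_append)
qed

lemma Theta_std_strict: "\<theta> \<in> Theta_std \<Longrightarrow> strict_omega_category \<theta>"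
  by (induction rule: Theta_std.induct) (rule bracket_strict)

lemma ocat_iso_refl: "strict_omega_category C \<Longrightarrow> ocat_iso C C"
  unfolding ocat_iso_def strict_functor_def by (intro exI[of _ id]) auto

lemma Theta_std_subset: "Theta_std \<subseteq> Theta"
  using ocat_iso_refl Theta_std_strict by (auto simp: Theta_def)

lemma bracket_objects: "objects (bracket \<theta>s) = (\<lambda>i. TCell i i []) ` {..length \<theta>s}"
proof -
  have "c \<in> objects (bracket \<theta>s) \<longleftrightarrow> c \<in> (\<lambda>i. TCell i i []) ` {..length \<theta>s}" for c
    by (cases c) (auto simp: objects_def bracket_cells)
  then show ?thesis by blast
qed

lemma bipointed_bp_bracket: "set \<theta>s \<subseteq> Theta_std \<Longrightarrow> bipointed (bp_bracket \<theta>s)"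
  using Theta_std_strict bracket_strict
  by (fastforce simp: bipointed_def bp_bracket_def bracket_objects)

lemma bp_bracket_Theta_nat:
  assumes "set \<theta>s \<subseteq> Theta_std" shows "bp_bracket \<theta>s \<in> Theta_nat"
proof -
  have "bipointed (bp_bracket \<theta>s)" by (rule bipointed_bp_bracket[OF assms])
  then have "bp_iso (bp_bracket \<theta>s) (bp_bracket \<theta>s)"
    unfolding bp_iso_def bp_functor_def strict_functor_def
    by (intro exI[of _ id]) (auto simp: bp_bracket_def bipointed_def)
  with assms show ?thesis by (auto simp: Theta_nat_def)
qed


lemma cube_0_cells: "cells (cube 0) = {cube_vertex []}"
proof -
  have "x = cube_vertex []" if x: "x \<in> cells (cube 0)" for x
  proof (intro ext)
    fix i \<alpha>
    have p: "x i \<alpha> \<in> pos_chains (cube_adc 0) i" and a: "chain_aug (cube_adc 0) (x 0 \<alpha>) = 1"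
      using x by (simp_all add: cube_def nu_def)
    show "x i \<alpha> = cube_vertex [] i \<alpha>"
    proof (cases "i = 0")
      case True
      have k: "Poly_Mapping.keys (x 0 \<alpha>) \<subseteq> {[]}" using p True by (auto simp: pos_chains_def)
      then have "chain_aug (cube_adc 0) (x 0 \<alpha>) = (\<Sum>b\<in>{[]}. Poly_Mapping.lookup (x 0 \<alpha>) b * aug (cube_adc 0) b)"
        unfolding chain_aug_def by (intro sum.mono_neutral_left) (auto simp: in_keys_iff)
      then have "Poly_Mapping.lookup (x 0 \<alpha>) [] = 1" using a by simp
      then have "x 0 \<alpha> = frag_of []"
        using k by (intro poly_mapping_eqI) (auto simp: lookup_single when_def in_keys_iff)
      then show ?thesis using True by (simp add: cube_vertex_def)
    next
      case False
      then have "Poly_Mapping.keys (x i \<alpha>) = {}" using p by (auto simp: pos_chains_def)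
      then show ?thesis using False by (simp add: cube_vertex_def)
    qed
  qed
  moreover have "cube_vertex [] \<in> cells (cube 0)"
    using cube_vertex_object[of "[]" 0] by (simp add: objects_def)
  ultimately show ?thesis by blast
qed

definition arrow_cell :: "interval list nu_cell" where
  "arrow_cell = (\<lambda>i \<alpha>. if i = 0 then frag_of [if \<alpha> then I1 else I0] else if i = 1 then frag_of [IE] else 0)"

lemma cube_1_adc:
  "basis (cube_adc (Suc 0)) = {[I0], [I1], [IE]}"
  "deg (cube_adc (Suc 0)) [b] = (if b = IE then 1 else 0)"
  "aug (cube_adc (Suc 0)) [b] = (if b = IE then 0 else 1)"
  "bd (cube_adc (Suc 0)) [b] = (if b = IE then frag_of [I1] - frag_of [I0] else 0)"
  using cube_adc_deg[of "[b]" "Suc 0"] cube_adc_aug[of "[b]" "Suc 0"] cube_adc_bd[of "[]" 0 b]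
    cube_adc_basis[of "Suc 0"]
  by (auto simp del: cube_adc.simps(2) simp: length_Suc_conv) (metis interval.exhaust)

lemma cube_1_cells: "cells (cube (Suc 0)) = {cube_vertex [I0], cube_vertex [I1], arrow_cell}"
proof (intro equalityI subsetI)
  fix x assume x: "x \<in> cells (cube (Suc 0))"
  let ?K = "cube_adc (Suc 0)"
  have p: "x i \<alpha> \<in> pos_chains ?K i" and a: "chain_aug ?K (x 0 \<alpha>) = 1"
    and d: "frag_extend (bd ?K) (x (Suc i) \<alpha>) = x i True - x i False" for i \<alpha>
    using x by (simp_all add: cube_def nu_def del: cube_adc.simps)
  let ?l = "\<lambda>i \<alpha>. Poly_Mapping.lookup (x i \<alpha>)"
  have k0: "Poly_Mapping.keys (x 0 \<alpha>) \<subseteq> {[I0], [I1]}" for \<alpha>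
    using p[of 0 \<alpha>] by (auto simp: pos_chains_def cube_1_adc simp del: cube_adc.simps)
  have k1: "Poly_Mapping.keys (x 1 \<alpha>) \<subseteq> {[IE]}" for \<alpha>
    using p[of 1 \<alpha>] by (auto simp: pos_chains_def cube_1_adc simp del: cube_adc.simps)
  have k2: "x i \<alpha> = 0" if "i \<ge> 2" for i \<alpha>
  proof -
    have "Poly_Mapping.keys (x i \<alpha>) = {}"
    proof (rule equals0I)
      fix b assume "b \<in> Poly_Mapping.keys (x i \<alpha>)"
      then have "b \<in> {[I0], [I1], [IE]}" "deg ?K b = i"
        using p[of i \<alpha>] by (auto simp: pos_chains_def cube_1_adc simp del: cube_adc.simps)
      then show False using that by (auto simp: cube_1_adc simp del: cube_adc.simps)
    qed
    then show ?thesis by simp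
  qed
  have nn: "?l i \<alpha> b \<ge> 0" for i \<alpha> b using p[of i \<alpha>] by (simp add: pos_chains_def)
  have s: "?l 0 \<alpha> [I0] + ?l 0 \<alpha> [I1] = 1" for \<alpha>
  proof -
    have "chain_aug ?K (x 0 \<alpha>) = (\<Sum>b\<in>{[I0], [I1]}. ?l 0 \<alpha> b * aug ?K b)"
      unfolding chain_aug_def using k0[of \<alpha>] by (intro sum.mono_neutral_left) (auto simp: in_keys_iff)
    then show ?thesis using a[of \<alpha>] by (simp add: cube_1_adc del: cube_adc.simps)
  qed
  have x0: "x 0 \<alpha> = frag_of [I0] \<and> ?l 0 \<alpha> [I1] = 0 \<or> x 0 \<alpha> = frag_of [I1] \<and> ?l 0 \<alpha> [I1] = 1" for \<alpha>
  proof -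
    have "?l 0 \<alpha> [I0] = 1 \<and> ?l 0 \<alpha> [I1] = 0 \<or> ?l 0 \<alpha> [I0] = 0 \<and> ?l 0 \<alpha> [I1] = 1"
      using s[of \<alpha>] nn[of 0 \<alpha> "[I0]"] nn[of 0 \<alpha> "[I1]"] by linarith
    then show ?thesis
      using k0[of \<alpha>] by (auto intro!: poly_mapping_eqI simp: lookup_single when_def in_keys_iff subset_iff) metis+
  qed
  have x1: "x 1 \<alpha> = frag_cmul (?l 1 \<alpha> [IE]) (frag_of [IE])" for \<alpha>
    using k1[of \<alpha>] by (auto intro!: poly_mapping_eqI simp: lookup_single when_def in_keys_iff subset_iff)
  have l1: "?l 1 \<alpha> [IE] = ?l 0 True [I1] - ?l 0 False [I1]" for \<alpha>
  proof -
    have "frag_extend (bd ?K) (x 1 \<alpha>) = frag_cmul (?l 1 \<alpha> [IE]) (frag_of [I1] - frag_of [I0])"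
      by (subst x1) (simp add: frag_extend_cmul cube_1_adc del: cube_adc.simps)
    then have "frag_cmul (?l 1 \<alpha> [IE]) (frag_of [I1] - frag_of [I0]) = x 0 True - x 0 False"
      using d[of 0 \<alpha>] by simp
    from arg_cong[OF this, of "\<lambda>c. Poly_Mapping.lookup c [I1]"] show ?thesis
      by (simp add: lookup_minus lookup_single)
  qed
  have expand: "x = y" if "\<And>\<alpha>. x 0 \<alpha> = y 0 \<alpha>" "\<And>\<alpha>. x 1 \<alpha> = y 1 \<alpha>" "\<And>i \<alpha>. i \<ge> (2::nat) \<Longrightarrow> y i \<alpha> = 0" for y
  proof (intro ext)
    fix i \<alpha>
    consider "i = (0::nat)" | "i = 1" | "i \<ge> 2" by linarith
    then show "x i \<alpha> = y i \<alpha>" using that k2 by cases auto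
  qed
  consider "?l 0 False [I1] = 0" "?l 0 True [I1] = 0" | "?l 0 False [I1] = 0" "?l 0 True [I1] = 1"
    | "?l 0 False [I1] = 1" "?l 0 True [I1] = 0" | "?l 0 False [I1] = 1" "?l 0 True [I1] = 1"
    using x0 by metis
  then show "x \<in> {cube_vertex [I0], cube_vertex [I1], arrow_cell}"
  proof cases
    case 1
    have "x = cube_vertex [I0]"
    proof (rule expand)
      show "x 0 \<alpha> = cube_vertex [I0] 0 \<alpha>" for \<alpha> using 1 x0[of \<alpha>] by (cases \<alpha>) (auto simp: cube_vertex_def)
      show "x 1 \<alpha> = cube_vertex [I0] 1 \<alpha>" for \<alpha> using 1 x1[of \<alpha>] l1[of \<alpha>] by (auto simp: cube_vertex_def)
    qed (auto simp: cube_vertex_def)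
    then show ?thesis by simp
  next
    case 2
    have "x = arrow_cell"
    proof (rule expand)
      show "x 0 \<alpha> = arrow_cell 0 \<alpha>" for \<alpha> using 2 x0[of \<alpha>] by (cases \<alpha>) (auto simp: arrow_cell_def)
      show "x 1 \<alpha> = arrow_cell 1 \<alpha>" for \<alpha> using 2 x1[of \<alpha>] l1[of \<alpha>] by (auto simp: arrow_cell_def)
    qed (auto simp: arrow_cell_def)
    then show ?thesis by simp
  next
    case 3
    then show ?thesis using l1[of True] nn[of 1 True "[IE]"] by simp
  next
    case 4
    have "x = cube_vertex [I1]"
    proof (rule expand)
      show "x 0 \<alpha> = cube_vertex [I1] 0 \<alpha>" for \<alpha> using 4 x0[of \<alpha>] by (cases \<alpha>) (auto simp: cube_vertex_def)
      show "x 1 \<alpha> = cube_vertex [I1] 1 \<alpha>" for \<alpha> using 4 x1[of \<alpha>] l1[of \<alpha>] by (auto simp: cube_vertex_def)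
    qed (auto simp: cube_vertex_def)
    then show ?thesis by simp
  qed
next
  fix x assume "x \<in> {cube_vertex [I0], cube_vertex [I1], arrow_cell}"
  moreover have "arrow_cell \<in> cells (cube (Suc 0))"
  proof -
    have "\<exists>N. \<forall>i\<ge>N. \<forall>\<alpha>. arrow_cell i \<alpha> = 0"
      by (rule exI[of _ 2]) (auto simp: arrow_cell_def)
    then show ?thesis
      by (auto simp: cube_def nu_def arrow_cell_def pos_chains_def chain_aug_def cube_1_adc lookup_single when_def
          simp del: cube_adc.simps)
  qed
  ultimately show "x \<in> cells (cube (Suc 0))"
    using cube_vertex_object[of "[I0]" "Suc 0"] cube_vertex_object[of "[I1]" "Suc 0"] by (auto simp: objects_def)
qed

text \<open>The \<open>1\<close>-cube is the arrow category.\<close>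

lemma cube_1_iso: "ocat_iso (cube 1) (bracket [bracket []])"
proof -
  let ?A = "cube (Suc 0)" and ?B = "bracket [bracket []]"
  let ?v0 = "cube_vertex [I0]" and ?v1 = "cube_vertex [I1]" and ?e = arrow_cell
  let ?w0 = "TCell 0 0 []" and ?w1 = "TCell (Suc 0) (Suc 0) []" and ?f = "TCell 0 (Suc 0) [TCell 0 0 []]"
  have neA: "?v0 \<noteq> ?v1" "?e \<noteq> ?v0" "?e \<noteq> ?v1"
  proof -
    have "?v0 0 True \<noteq> ?v1 0 True" "?e 1 True \<noteq> ?v0 1 True" "?e 1 True \<noteq> ?v1 1 True"
      by (auto simp: cube_vertex_def arrow_cell_def frag_of_eq)
    then show "?v0 \<noteq> ?v1" "?e \<noteq> ?v0" "?e \<noteq> ?v1" by metis+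
  qed
  have sA: "src ?A n ?v0 = ?v0" "tgt ?A n ?v0 = ?v0" "src ?A n ?v1 = ?v1" "tgt ?A n ?v1 = ?v1"
    "src ?A n ?e = (if n = 0 then ?v0 else ?e)" "tgt ?A n ?e = (if n = 0 then ?v1 else ?e)" for n
    by (auto simp: cube_def nu_def nu_trunc_def cube_vertex_def arrow_cell_def fun_eq_iff)
  have H: "hom_ocat [bracket []] 0 (Suc 0) = prod_ocat [bracket []]" by (simp add: hom_ocat_def)
  have b0: "c \<in> cells (bracket []) \<longleftrightarrow> c = TCell 0 0 []" for c by (cases c) (auto simp: bracket_cells)
  have "cells ?B = {?w0, ?w1, ?f}"
  proof (intro set_eqI)
    fix c
    obtain i j xs where c: "c = TCell i j xs" by (cases c)
    have "i \<le> j \<and> j \<le> 1 \<longleftrightarrow> i = 0 \<and> j = 0 \<or> i = 0 \<and> j = 1 \<or> i = 1 \<and> j = 1" by linarith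
    then show "c \<in> cells ?B \<longleftrightarrow> c \<in> {?w0, ?w1, ?f}"
      unfolding c bracket_cells by (auto simp: H prod_cells length_Suc_conv b0)
  qed
  note cB = this
  have e0: "src (bracket []) n (TCell 0 0 []) = TCell 0 0 []" "tgt (bracket []) n (TCell 0 0 []) = TCell 0 0 []" for n
    by (cases n; simp)+
  have sB: "src ?B n ?w0 = ?w0" "tgt ?B n ?w0 = ?w0" "src ?B n ?w1 = ?w1" "tgt ?B n ?w1 = ?w1"
    "src ?B n ?f = (if n = 0 then ?w0 else ?f)" "tgt ?B n ?f = (if n = 0 then ?w1 else ?f)" for n
    by (cases n; simp add: H prod_ocat_def e0)+
  have SA: "strict_omega_category ?A" by (rule cube_strict)
  have SB: "strict_omega_category ?B" by (auto intro!: bracket_strict)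
  define F where "F = (\<lambda>x. if x = ?v0 then ?w0 else if x = ?v1 then ?w1 else ?f)"
  define G where "G = (\<lambda>x. if x = ?w0 then ?v0 else if x = ?w1 then ?v1 else ?e)"
  have Fv: "F ?v0 = ?w0" "F ?v1 = ?w1" "F ?e = ?f" "G ?w0 = ?v0" "G ?w1 = ?v1" "G ?f = ?e"
    using neA by (auto simp: F_def G_def)
  have degA: "x = tgt ?A n x \<or> y = src ?A n y"
    if "x \<in> cells ?A" "y \<in> cells ?A" "tgt ?A n x = src ?A n y" for x y n
    using that neA unfolding cube_1_cells by (auto simp: sA split: if_splits)
  have degB: "x = tgt ?B n x \<or> y = src ?B n y"
    if "x \<in> cells ?B" "y \<in> cells ?B" "tgt ?B n x = src ?B n y" for x y n
    using that unfolding cB by (auto simp: sB split: if_splits)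
  have FF: "strict_functor ?A ?B F"
    unfolding strict_functor_def
  proof (intro conjI allI ballI impI SA SB)
    fix x y n assume xy: "x \<in> cells ?A" "y \<in> cells ?A"
    show Fx: "F x \<in> cells ?B" "F (src ?A n x) = src ?B n (F x)" "F (tgt ?A n x) = tgt ?B n (F x)"
      if "x \<in> cells ?A" for x n
      using that unfolding cube_1_cells cB by (auto simp: sA sB Fv)
    assume c: "tgt ?A n x = src ?A n y"
    from degA[OF xy c] show "F (ocomp ?A n x y) = ocomp ?B n (F x) (F y)"
    proof
      assume "x = tgt ?A n x"
      then have "x = src ?A n y" using c by simp
      then show ?thesis
        using xy Fx strict_omega_category.comp_src[OF SA] strict_omega_category.comp_src[OF SB] by simp
    next
      assume "y = src ?A n y"
      then have "y = tgt ?A n x" using c by simp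
      then show ?thesis
        using xy Fx strict_omega_category.comp_tgt[OF SA] strict_omega_category.comp_tgt[OF SB] by simp
    qed
  qed
  have GG: "strict_functor ?B ?A G"
    unfolding strict_functor_def
  proof (intro conjI allI ballI impI SA SB)
    fix x y n assume xy: "x \<in> cells ?B" "y \<in> cells ?B"
    show Gx: "G x \<in> cells ?A" "G (src ?B n x) = src ?A n (G x)" "G (tgt ?B n x) = tgt ?A n (G x)"
      if "x \<in> cells ?B" for x n
      using that unfolding cube_1_cells cB by (auto simp: sA sB Fv)
    assume c: "tgt ?B n x = src ?B n y"
    from degB[OF xy c] show "G (ocomp ?B n x y) = ocomp ?A n (G x) (G y)"
    proof
      assume "x = tgt ?B n x"
      then have "x = src ?B n y" using c by simp
      then show ?thesis
        using xy Gx strict_omega_category.comp_src[OF SA] strict_omega_category.comp_src[OF SB] by simp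
    next
      assume "y = src ?B n y"
      then have "y = tgt ?B n x" using c by simp
      then show ?thesis
        using xy Gx strict_omega_category.comp_tgt[OF SA] strict_omega_category.comp_tgt[OF SB] by simp
    qed
  qed
  have "\<forall>x \<in> cells ?A. G (F x) = x" "\<forall>y \<in> cells ?B. F (G y) = y"
    unfolding cube_1_cells cB by (auto simp: Fv)
  with FF GG show ?thesis unfolding ocat_iso_def One_nat_def by blast
qed

end

theory Submission
  imports Defs
begin

text \<open>
  The object \<open>[k](\<theta>\<^sub>1,\<dots>,\<theta>\<^sub>k)\<close> is \<open>\<nu>(K)\<close> for the augmented directed complex \<open>K\<close> with the objects
  \<open>0,\<dots>,k\<close> in degree \<open>0\<close> and the suspended generators of \<open>\<theta>\<^sub>p\<close> as generators from \<open>p - 1\<close> to \<open>p\<close>: a cell of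
  \<open>\<nu>(K)\<close> splits into its end points \<open>i \<le> j\<close> and one cell of each \<open>\<theta>\<^sub>p\<close> with \<open>i < p \<le> j\<close>, the other
  components vanishing because \<open>K\<close> has no positive cycles. As \<open>\<nu>\<close> is a functor, it suffices that \<open>K\<close> is a
  retract of the complex of a cube. By induction on \<open>k\<close> this amounts to the following: if \<open>K\<close> is a
  bipointed retract of the \<open>N\<close>-cube and \<open>Q\<close> is a retract of the \<open>n\<close>-cube, then the wedge of \<open>K\<close> with
  the suspension of \<open>Q\<close> is a bipointed retract of the cube of dimension \<open>N + n + 1\<close>. Both maps of this
  retract are explicit, and they are made of the two contractions of the cube, to its first and to its
  last vertex, which preserve positive chains if the sign is chosen appropriately.
\<close>

section \<open>Chains\<close>

text \<open>The linear extension of an integer weight on generators. It is detached from any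
  complex, so that one calculus serves the weights \<open>word_aug\<close> and
  \<open>tree_aug\<close> alike.\<close>

definition chain_sum :: "('b \<Rightarrow> int) \<Rightarrow> ('b \<Rightarrow>\<^sub>0 int) \<Rightarrow> int" where
  "chain_sum a c = (\<Sum>b \<in> Poly_Mapping.keys c. Poly_Mapping.lookup c b * a b)"

lemma chain_aug_eq: "chain_aug K = chain_sum (aug K)"
  by (simp add: chain_aug_def chain_sum_def fun_eq_iff)

lemma chain_sum_superset:
  assumes "finite A" "Poly_Mapping.keys c \<subseteq> A"
  shows "chain_sum a c = (\<Sum>b\<in>A. Poly_Mapping.lookup c b * a b)"
  unfolding chain_sum_def using assms by (intro sum.mono_neutral_left) (auto simp: in_keys_iff)

lemma chain_sum_frag_of [simp]: "chain_sum a (frag_of b) = a b"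
  by (simp add: chain_sum_def)

lemma chain_sum_zero [simp]: "chain_sum a 0 = 0"
  by (simp add: chain_sum_def)

lemma chain_sum_add [simp]: "chain_sum a (c + d) = chain_sum a c + chain_sum a d"
proof -
  let ?A = "Poly_Mapping.keys c \<union> Poly_Mapping.keys d"
  have "Poly_Mapping.keys (c + d) \<subseteq> ?A" by (rule keys_add)
  then show ?thesis
    by (simp add: chain_sum_superset[of ?A] lookup_add sum.distrib distrib_right)
qed

lemma chain_sum_cmul [simp]: "chain_sum a (frag_cmul k c) = k * chain_sum a c"
proof -
  have "Poly_Mapping.keys (frag_cmul k c) \<subseteq> Poly_Mapping.keys c" by (rule keys_cmul)
  then show ?thesis
    by (simp add: chain_sum_superset[of "Poly_Mapping.keys c"] sum_distrib_left mult.assoc)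
qed

lemma chain_sum_minus [simp]: "chain_sum a (- c) = - chain_sum a c"
  using chain_sum_cmul[of a "-1" c] by simp

lemma chain_sum_diff [simp]: "chain_sum a (c - d) = chain_sum a c - chain_sum a d"
  using chain_sum_add[of a c "- d"] by simp

lemma chain_sum_sum: "chain_sum a (\<Sum>i\<in>I. c i) = (\<Sum>i\<in>I. chain_sum a (c i))"
  by (induction I rule: infinite_finite_induct) auto

lemma chain_sum_cong:
  "(\<And>b. b \<in> Poly_Mapping.keys c \<Longrightarrow> a b = a' b) \<Longrightarrow> chain_sum a c = chain_sum a' c"
  by (simp add: chain_sum_def)

lemma chain_sum_eq_0: "(\<And>b. b \<in> Poly_Mapping.keys c \<Longrightarrow> a b = 0) \<Longrightarrow> chain_sum a c = 0"
  by (simp add: chain_sum_def)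

lemma chain_sum_mult [simp]:
  "chain_sum (\<lambda>x. a x * m) c = chain_sum a c * m" "chain_sum (\<lambda>x. m * a x) c = m * chain_sum a c"
  by (simp_all add: chain_sum_def sum_distrib_left sum_distrib_right mult.assoc mult.left_commute)

lemma frag_extend_const_cmul: "frag_extend (\<lambda>x. frag_cmul (a x) y) c = frag_cmul (chain_sum a c) y"
  by (rule poly_mapping_eqI)
     (simp add: frag_extend_def chain_sum_def lookup_sum sum_distrib_right mult.assoc)

lemma chain_sum_frag_extend: "chain_sum a (frag_extend f c) = chain_sum (\<lambda>x. chain_sum a (f x)) c"
  by (simp add: frag_extend_def chain_sum_sum) (simp add: chain_sum_def)

lemma frag_extend_add_fun: "frag_extend (\<lambda>x. f x + g x) c = frag_extend f c + frag_extend g c"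
  by (simp add: frag_extend_def frag_cmul_distrib2 sum.distrib)

lemma frag_extend_cmul_fun: "frag_extend (\<lambda>x. frag_cmul k (f x)) c = frag_cmul k (frag_extend f c)"
  by (simp add: frag_extend_def frag_cmul_sum mult.commute)

lemma frag_extend_minus_fun: "frag_extend (\<lambda>x. - f x) c = - frag_extend f c"
  using frag_extend_cmul_fun[of "-1" f c] by simp

lemma frag_extend_diff_fun: "frag_extend (\<lambda>x. f x - g x) c = frag_extend f c - frag_extend g c"
  using frag_extend_add_fun[of f "\<lambda>x. - g x" c] by (simp add: frag_extend_minus_fun)

lemma frag_extend_zero_fun [simp]: "frag_extend (\<lambda>x. 0) c = 0"
  by (simp add: frag_extend_eq_0)

lemma frag_cmul_minus_right [simp]: "frag_cmul k (- c) = - frag_cmul k c"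
  by (rule poly_mapping_eqI) simp

lemma frag_cmul_diff_right: "frag_cmul k (c - d) = frag_cmul k c - frag_cmul k d"
  by (rule poly_mapping_eqI) (simp add: lookup_minus right_diff_distrib)

lemmas frag_linear =
  frag_extend_add frag_extend_diff frag_extend_minus frag_extend_cmul frag_extend_frag_extend
  frag_extend_add_fun frag_extend_diff_fun frag_extend_minus_fun frag_extend_cmul_fun frag_extend_const_cmul
  frag_cmul_distrib frag_cmul_diff_distrib frag_cmul_distrib2 frag_cmul_diff_right

section \<open>Morphisms of augmented directed complexes\<close>

lemma pos_chains_cmul: "c \<in> pos_chains K i \<Longrightarrow> k \<ge> 0 \<Longrightarrow> frag_cmul k c \<in> pos_chains K i"
  by (auto simp: pos_chains_def)

lemma pos_chains_sum: "(\<And>j. j \<in> I \<Longrightarrow> c j \<in> pos_chains K i) \<Longrightarrow> sum c I \<in> pos_chains K i"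
  by (induction I rule: infinite_finite_induct) (auto simp: pos_chains_0 pos_chains_add)

lemma pos_chains_frag_of: "b \<in> basis K \<Longrightarrow> deg K b = i \<Longrightarrow> frag_of b \<in> pos_chains K i"
  by (auto simp: pos_chains_def)

lemma pos_chains_frag_extend:
  assumes "c \<in> pos_chains K i" "\<And>b. b \<in> basis K \<Longrightarrow> deg K b = i \<Longrightarrow> f b \<in> pos_chains L j"
  shows "frag_extend f c \<in> pos_chains L j"
  unfolding frag_extend_def using assms
  by (intro pos_chains_sum pos_chains_cmul) (auto simp: pos_chains_def)

text \<open>The condition on augmentations runs over all degrees; for the complexes of cubes and
  trees, whose \<open>aug\<close> vanishes in positive degree, it has content in degree 0
  only.\<close>

definition adc_map :: "'b adc \<Rightarrow> 'c adc \<Rightarrow> ('b \<Rightarrow> ('c \<Rightarrow>\<^sub>0 int)) \<Rightarrow> bool" where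
  "adc_map K L f \<longleftrightarrow> (\<forall>b \<in> basis K.
     f b \<in> pos_chains L (deg K b) \<and>
     frag_extend (bd L) (f b) = frag_extend f (bd K b) \<and>
     chain_aug L (f b) = aug K b)"

definition adc_retract :: "'b adc \<Rightarrow> 'c adc \<Rightarrow> ('b \<Rightarrow> ('c \<Rightarrow>\<^sub>0 int)) \<Rightarrow> ('c \<Rightarrow> ('b \<Rightarrow>\<^sub>0 int)) \<Rightarrow> bool" where
  "adc_retract K L f g \<longleftrightarrow>
     adc_map K L f \<and> adc_map L K g \<and> (\<forall>b \<in> basis K. frag_extend g (f b) = frag_of b)"

definition nu_map :: "('b \<Rightarrow> ('c \<Rightarrow>\<^sub>0 int)) \<Rightarrow> 'b nu_cell \<Rightarrow> 'c nu_cell" where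
  "nu_map f x = (\<lambda>i \<alpha>. frag_extend f (x i \<alpha>))"

lemma nu_cellD:
  assumes "x \<in> cells (nu K)"
  shows "x i \<alpha> \<in> pos_chains K i" "chain_aug K (x 0 \<alpha>) = 1"
    "frag_extend (bd K) (x (Suc i) \<alpha>) = x i True - x i False"
    "Poly_Mapping.keys (x i \<alpha>) \<subseteq> basis K"
  using assms by (auto simp: nu_def pos_chains_def)

text \<open>Truncation and composition of cells are formed from their chains by selection, sums and
  differences, so a linear map commutes with both; \<open>adc_map\<close> enters to show that images
  are cells again.\<close>

lemma nu_map_functor:
  assumes "adc_map K L f"
  shows "strict_functor (nu K) (nu L) (nu_map f)"
proof -
  have st: "src (nu M) = nu_trunc False" "tgt (nu M) = nu_trunc True" for M :: "'z adc"
    by (auto simp: nu_def)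
  have trunc: "nu_map f (nu_trunc \<alpha> n x) = nu_trunc \<alpha> n (nu_map f x)" for \<alpha> n x
    by (auto simp: nu_map_def nu_trunc_def fun_eq_iff)
  have comp: "nu_map f (ocomp (nu K) n x y) = ocomp (nu L) n (nu_map f x) (nu_map f y)" for n x y
    by (auto simp: nu_map_def nu_def nu_trunc_def fun_eq_iff frag_linear)
  have cell: "nu_map f x \<in> cells (nu L)" if x: "x \<in> cells (nu K)" for x
  proof -
    note xD = nu_cellD[OF x]
    have f: "f b \<in> pos_chains L (deg K b)" "frag_extend (bd L) (f b) = frag_extend f (bd K b)"
      "chain_sum (aug L) (f b) = aug K b" if "b \<in> basis K" for b
      using assms that by (auto simp: adc_map_def chain_aug_eq)
    have "nu_map f x i \<alpha> \<in> pos_chains L i" for i \<alpha>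
      unfolding nu_map_def using xD(1) by (rule pos_chains_frag_extend) (use f in auto)
    moreover have "chain_aug L (nu_map f x 0 \<alpha>) = 1" for \<alpha>
    proof -
      have "chain_aug L (nu_map f x 0 \<alpha>) = chain_sum (aug K) (x 0 \<alpha>)"
        unfolding nu_map_def chain_aug_eq chain_sum_frag_extend
        by (rule chain_sum_cong) (use f xD(4) in blast)
      then show ?thesis using xD(2) by (simp add: chain_aug_eq)
    qed
    moreover have "frag_extend (bd L) (nu_map f x (Suc i) \<alpha>) = nu_map f x i True - nu_map f x i False" for i \<alpha>
    proof -
      have "frag_extend (bd L) (nu_map f x (Suc i) \<alpha>) = frag_extend (\<lambda>b. frag_extend f (bd K b)) (x (Suc i) \<alpha>)"
        unfolding nu_map_def frag_extend_frag_extend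
        by (rule frag_extend_eq) (use f xD(4) in blast)
      also have "\<dots> = frag_extend f (x i True - x i False)"
        by (simp add: frag_extend_frag_extend[symmetric] xD(3))
      finally show ?thesis by (simp add: nu_map_def frag_extend_diff)
    qed
    moreover have "\<exists>N. \<forall>i\<ge>N. \<forall>\<alpha>. nu_map f x i \<alpha> = 0"
      using x by (fastforce simp: nu_def nu_map_def)
    ultimately show ?thesis by (simp add: nu_def)
  qed
  show ?thesis
    unfolding strict_functor_def by (simp add: nu_strict cell comp st trunc)
qed

lemma nu_map_retract:
  assumes "adc_retract K L f g" "x \<in> cells (nu K)"
  shows "nu_map g (nu_map f x) = x"
proof (intro ext)
  fix i \<alpha>
  have "frag_extend (\<lambda>b. frag_extend g (f b)) (x i \<alpha>) = frag_extend frag_of (x i \<alpha>)"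
    using assms nu_cellD(4)[OF assms(2)] by (intro frag_extend_eq) (auto simp: adc_retract_def)
  then show "nu_map g (nu_map f x) i \<alpha> = x i \<alpha>"
    by (simp add: nu_map_def frag_extend_frag_extend frag_expansion[symmetric])
qed

section \<open>Functors and retracts\<close>

lemma strict_functor_compose:
  assumes "strict_functor C D F" "strict_functor D E G"
  shows "strict_functor C E (G \<circ> F)"
proof -
  have "tgt D n (F x) = src D n (F y)" if "x \<in> cells C" "y \<in> cells C" "tgt C n x = src C n y" for n x y
    using assms(1) that unfolding strict_functor_def by metis
  then show ?thesis using assms unfolding strict_functor_def by simp
qed

lemma bp_functor_compose:
  assumes "bp_functor P Q F" "bp_functor Q R G"
  shows "bp_functor P R (G \<circ> F)"
  using assms strict_functor_compose by (force simp: bp_functor_def split: prod.splits)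

lemma bp_retract_trans:
  assumes "bp_retract P Q" "bp_retract Q R" shows "bp_retract P R"
proof -
  obtain i r j s where ir: "bp_functor P Q i" "bp_functor Q P r" "\<forall>x \<in> cells (fst P). r (i x) = x"
    and js: "bp_functor Q R j" "bp_functor R Q s" "\<forall>x \<in> cells (fst Q). s (j x) = x"
    using assms unfolding bp_retract_def by blast
  have "i x \<in> cells (fst Q)" if "x \<in> cells (fst P)" for x
    using ir(1) that by (auto simp: bp_functor_def strict_functor_def split: prod.splits)
  then have "\<forall>x \<in> cells (fst P). (r \<circ> s) ((j \<circ> i) x) = x" using ir(3) js(3) by simp
  then show ?thesis
    using bp_functor_compose[OF ir(1) js(1)] bp_functor_compose[OF js(2) ir(2)]
    unfolding bp_retract_def by blast
qed

lemma ocat_retract_trans: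
  assumes "ocat_retract C D" "ocat_retract D E" shows "ocat_retract C E"
proof -
  obtain i r j s where ir: "strict_functor C D i" "strict_functor D C r" "\<forall>x \<in> cells C. r (i x) = x"
    and js: "strict_functor D E j" "strict_functor E D s" "\<forall>x \<in> cells D. s (j x) = x"
    using assms unfolding ocat_retract_def by blast
  have "i x \<in> cells D" if "x \<in> cells C" for x
    using ir(1) that by (auto simp: strict_functor_def)
  then have "\<forall>x \<in> cells C. (r \<circ> s) ((j \<circ> i) x) = x" using ir(3) js(3) by simp
  then show ?thesis
    using strict_functor_compose[OF ir(1) js(1)] strict_functor_compose[OF js(2) ir(2)]
    unfolding ocat_retract_def by blast
qed

lemma bp_iso_retract: "bp_iso P Q \<Longrightarrow> bp_retract P Q"
  unfolding bp_iso_def bp_retract_def by blast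

lemma ocat_iso_retract: "ocat_iso C D \<Longrightarrow> ocat_retract C D"
  unfolding ocat_iso_def ocat_retract_def by blast

lemma bp_retract_ocat_retract: "bp_retract P Q \<Longrightarrow> ocat_retract (fst P) (fst Q)"
  unfolding bp_retract_def ocat_retract_def bp_functor_def by (auto split: prod.splits)

lemma strict_functor_inverse:
  assumes F: "strict_functor C D F" and bij: "bij_betw F (cells C) (cells D)"
  shows "strict_functor D C (the_inv_into (cells C) F)"
proof -
  let ?G = "the_inv_into (cells C) F"
  have inj: "inj_on F (cells C)" using bij by (rule bij_betw_imp_inj_on)
  have SC: "strict_omega_category C" and SD: "strict_omega_category D"
    and F1: "\<And>x. x \<in> cells C \<Longrightarrow> F x \<in> cells D"
    and F2: "\<And>n x. x \<in> cells C \<Longrightarrow> F (src C n x) = src D n (F x)"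
      "\<And>n x. x \<in> cells C \<Longrightarrow> F (tgt C n x) = tgt D n (F x)"
    and F3: "\<And>n x y. x \<in> cells C \<Longrightarrow> y \<in> cells C \<Longrightarrow> tgt C n x = src C n y \<Longrightarrow>
      F (ocomp C n x y) = ocomp D n (F x) (F y)"
    using F by (auto simp: strict_functor_def)
  interpret C: strict_omega_category C by (rule SC)
  have GF: "?G (F x) = x" if "x \<in> cells C" for x using inj that by (rule the_inv_into_f_f)
  have ex: "\<exists>x \<in> cells C. y = F x" if "y \<in> cells D" for y using bij that by (auto simp: bij_betw_def)
  show ?thesis
    unfolding strict_functor_def
  proof (intro conjI allI ballI impI SC SD)
    fix y assume "y \<in> cells D"
    then obtain x where x: "x \<in> cells C" "y = F x" using ex by blast
    show "?G y \<in> cells C" using x GF by simp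
    fix n
    show "?G (src D n y) = src C n (?G y)"
      using x GF F2(1)[symmetric] C.src_closed by simp
    show "?G (tgt D n y) = tgt C n (?G y)"
      using x GF F2(2)[symmetric] C.tgt_closed by simp
    fix z assume "z \<in> cells D" and c: "tgt D n y = src D n z"
    then obtain w where w: "w \<in> cells C" "z = F w" using ex by blast
    \<comment> \<open>Composability has to be reflected to the preimages: \<open>F\<close> commutes
      with sources and targets and is injective on cells.\<close>
    have "F (tgt C n x) = F (src C n w)" using c x w F2 by simp
    then have "tgt C n x = src C n w"
      using inj x w C.src_closed C.tgt_closed by (auto dest: inj_onD)
    then show "?G (ocomp D n y z) = ocomp C n (?G y) (?G z)"
      using x w GF F3[symmetric] C.comp_closed by simp
  qed
qed

section \<open>The complex of the cube\<close>

declare cube_adc.simps(2) [simp del]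

definition word_sign :: "interval list \<Rightarrow> int" where
  "word_sign w = (-1) ^ count_list w IE"

definition word_aug :: "interval list \<Rightarrow> int" where
  "word_aug w = (if IE \<in> set w then 0 else 1)"

text \<open>One boundary map for words of all lengths, so that words can be concatenated and split
  without tracking the dimension of the cube.\<close>

primrec word_bd :: "interval list \<Rightarrow> (interval list \<Rightarrow>\<^sub>0 int)" where
  "word_bd [] = 0"
| "word_bd (b # w) = (if b = IE then frag_of (I1 # w) - frag_of (I0 # w) else 0)
    + frag_cmul (if b = IE then -1 else 1) (frag_extend (\<lambda>v. frag_of (b # v)) (word_bd w))"

lemma word_sign_simps [simp]:
  "word_sign [] = 1" "word_sign (b # w) = (if b = IE then - word_sign w else word_sign w)"
  by (simp_all add: word_sign_def)

lemma word_aug_simps [simp]: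
  "word_aug [] = 1" "word_aug (b # w) = (if b = IE then 0 else word_aug w)"
  by (simp_all add: word_aug_def)

lemma word_aug_append [simp]: "word_aug (u @ w) = word_aug u * word_aug w"
  by (simp add: word_aug_def)

lemma word_aug_replicate [simp]: "b \<noteq> IE \<Longrightarrow> word_aug (replicate n b) = 1"
  by (simp add: word_aug_def)

lemma word_bd_cube: "length w = n \<Longrightarrow> bd (cube_adc n) w = word_bd w"
proof (induction w arbitrary: n)
  case (Cons b w)
  then obtain m where "n = Suc m" "length w = m" by (cases n) auto
  with Cons.IH[of m] show ?case by (simp add: cube_adc_bd)
qed simp

lemma word_bd_keys: "v \<in> Poly_Mapping.keys (word_bd w) \<Longrightarrow>
    length v = length w \<and> Suc (count_list v IE) = count_list w IE"
proof (induction w arbitrary: v)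
  case (Cons b w)
  let ?c = "frag_extend (\<lambda>v. frag_of (b # v)) (word_bd w)"
  have c: "v \<in> (#) b ` Poly_Mapping.keys (word_bd w)" if "v \<in> Poly_Mapping.keys ?c" for v
    using keys_frag_extend[of "\<lambda>v. frag_of (b # v)" "word_bd w"] that by (auto simp: keys_frag_of)
  have "v \<in> Poly_Mapping.keys ?c \<or> b = IE \<and> (v = I1 # w \<or> v = I0 # w)"
  proof (cases "b = IE")
    case True
    have "v \<in> Poly_Mapping.keys (frag_of (I1 # w)) \<union> Poly_Mapping.keys (frag_of (I0 # w)) \<union> Poly_Mapping.keys ?c"
      using Cons.prems True keys_diff[of "frag_of (I1 # w) - frag_of (I0 # w)" ?c]
        keys_diff[of "frag_of (I1 # w)" "frag_of (I0 # w)"] by auto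
    then show ?thesis using True by (auto simp: keys_frag_of)
  qed (use Cons.prems in simp)
  then show ?case using c Cons.IH by fastforce
qed simp

lemma word_aug_bd [simp]: "chain_sum word_aug (word_bd w) = 0"
proof (induction w)
  case (Cons b w)
  have "chain_sum (\<lambda>v. word_aug (b # v)) (word_bd w) = (if b = IE then 0 else chain_sum word_aug (word_bd w))"
    by (simp add: chain_sum_def)
  then show ?case using Cons.IH by (simp add: chain_sum_frag_extend)
qed simp

text \<open>The Leibniz rule: concatenation of words is the tensor product of generators, and the
  sign is that of the degree of \<open>u\<close>.\<close>

lemma word_bd_append:
  "word_bd (u @ w) = frag_extend (\<lambda>u'. frag_of (u' @ w)) (word_bd u)
    + frag_cmul (word_sign u) (frag_extend (\<lambda>w'. frag_of (u @ w')) (word_bd w))"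
proof (induction u)
  case Nil
  then show ?case by (simp add: frag_expansion[symmetric])
next
  case (Cons b u)
  then show ?case by (cases b) (simp_all add: frag_linear)
qed

lemma word_bd_vertex: "IE \<notin> set u \<Longrightarrow> word_bd u = 0"
  by (induction u) auto

lemma word_bd_vertex_append:
  "IE \<notin> set u \<Longrightarrow> word_bd (u @ w) = frag_extend (\<lambda>w'. frag_of (u @ w')) (word_bd w)"
  by (simp add: word_bd_append word_bd_vertex word_sign_def count_list_0_iff)

subsection \<open>Directed contractions of the cube\<close>

text \<open>
  \<open>contr0\<close> and \<open>contr1\<close> are, up to the sign \<^term>\<open>word_sign\<close>, chain homotopies between the identity and
  the projections to the first and the last vertex. The sign is what makes them preserve positivity.
\<close>

primrec contr0 :: "interval list \<Rightarrow> (interval list \<Rightarrow>\<^sub>0 int)" where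
  "contr0 [] = 0"
| "contr0 (b # w) = frag_extend (\<lambda>v. frag_of (b # v)) (contr0 w)
    + (if b = I1 then frag_cmul (word_aug w) (frag_of (IE # replicate (length w) I0)) else 0)"

primrec contr1 :: "interval list \<Rightarrow> (interval list \<Rightarrow>\<^sub>0 int)" where
  "contr1 [] = 0"
| "contr1 (b # w) = frag_extend (\<lambda>v. frag_of (b # v)) (contr1 w)
    + (if b = I0 then frag_cmul (word_aug w) (frag_of (IE # replicate (length w) I1)) else 0)"

lemma frag_extend_word_bd_length:
  assumes "\<And>v. length v = length w \<Longrightarrow> f v = g v"
  shows "frag_extend f (word_bd w) = frag_extend g (word_bd w)"
  using assms word_bd_keys by (blast intro: frag_extend_eq)

text \<open>For a vertex \<open>w\<close>, the chain \<open>contr0 w\<close> is the edge path from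
  the first vertex to \<open>w\<close> that raises coordinates from left to right, and the formula
  records its end points. The recursion contracts the tail first and then the first letter; the
  latter contributes an edge only over a vertex.\<close>

lemma contr0_bd:
  "frag_extend word_bd (contr0 w) = frag_extend contr0 (word_bd w) + frag_cmul (word_sign w) (frag_of w)
    - frag_cmul (word_aug w) (frag_of (replicate (length w) I0))"
proof (induction w)
  case (Cons b w)
  \<comment> \<open>All words of the boundary have the length of \<open>w\<close>, so the edge is
    the same in every summand, and the weights \<open>word_aug\<close> over a boundary add up to
    0.\<close>
  have *: "frag_extend (\<lambda>v. frag_cmul (word_aug v) (frag_of (IE # replicate (length v) I0))) (word_bd w) = 0"
    by (subst frag_extend_word_bd_length[of _ _ "\<lambda>v. frag_cmul (word_aug v) (frag_of (IE # replicate (length w) I0))"])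
       (simp_all add: frag_linear)
  show ?case using arg_cong[OF Cons.IH, of "frag_extend (\<lambda>v. frag_of (b # v))"]
    by (cases b) (simp_all add: frag_linear * word_bd_vertex)
qed simp

text \<open>The signs are opposite to those for \<open>contr0\<close>: for a vertex \<open>w\<close>
  the chain is a path from \<open>w\<close> to the last vertex, which raises coordinates from right
  to left.\<close>

lemma contr1_bd:
  "frag_extend word_bd (contr1 w) = frag_extend contr1 (word_bd w) - frag_cmul (word_sign w) (frag_of w)
    + frag_cmul (word_aug w) (frag_of (replicate (length w) I1))"
proof (induction w)
  case (Cons b w)
  have *: "frag_extend (\<lambda>v. frag_cmul (word_aug v) (frag_of (IE # replicate (length v) I1))) (word_bd w) = 0"
    by (subst frag_extend_word_bd_length[of _ _ "\<lambda>v. frag_cmul (word_aug v) (frag_of (IE # replicate (length w) I1))"])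
       (simp_all add: frag_linear)
  show ?case using arg_cong[OF Cons.IH, of "frag_extend (\<lambda>v. frag_of (b # v))"]
    by (cases b) (simp_all add: frag_linear * word_bd_vertex)
qed simp

section \<open>Positivity and augmentation of the contractions\<close>

lemma cube_pos_chains:
  "c \<in> pos_chains (cube_adc n) i \<longleftrightarrow>
    (\<forall>w \<in> Poly_Mapping.keys c. length w = n \<and> count_list w IE = i) \<and> (\<forall>w. Poly_Mapping.lookup c w \<ge> 0)"
  by (auto simp: pos_chains_def cube_adc_basis cube_adc_deg)

lemma cube_word_pos:
  "length w = n \<Longrightarrow> count_list w IE = i \<Longrightarrow> frag_of w \<in> pos_chains (cube_adc n) i"
  by (simp add: cube_pos_chains)

lemma cube_chain_aug:
  assumes "\<And>w. w \<in> Poly_Mapping.keys c \<Longrightarrow> length w = n"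
  shows "chain_aug (cube_adc n) c = chain_sum word_aug c"
  unfolding chain_aug_eq by (rule chain_sum_cong) (simp add: assms cube_adc_aug word_aug_def)

lemma contr0_pos: "contr0 w \<in> pos_chains (cube_adc (length w)) (Suc (count_list w IE))"
proof (induction w)
  case (Cons b w)
  have "frag_extend (\<lambda>v. frag_of (b # v)) (contr0 w) \<in> pos_chains (cube_adc (Suc (length w))) (Suc (count_list (b # w) IE))"
    using Cons.IH by (rule pos_chains_frag_extend) (auto simp: cube_adc_basis cube_adc_deg intro!: cube_word_pos)
  then show ?case
    by (auto intro!: pos_chains_add cube_word_pos simp: word_aug_def count_list_0_iff)
qed (simp add: pos_chains_0)

lemma contr1_pos: "contr1 w \<in> pos_chains (cube_adc (length w)) (Suc (count_list w IE))"
proof (induction w)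
  case (Cons b w)
  have "frag_extend (\<lambda>v. frag_of (b # v)) (contr1 w) \<in> pos_chains (cube_adc (Suc (length w))) (Suc (count_list (b # w) IE))"
    using Cons.IH by (rule pos_chains_frag_extend) (auto simp: cube_adc_basis cube_adc_deg intro!: cube_word_pos)
  then show ?case
    by (auto intro!: pos_chains_add cube_word_pos simp: word_aug_def count_list_0_iff)
qed (simp add: pos_chains_0)

lemma word_aug_pos_chain: "c \<in> pos_chains (cube_adc n) (Suc i) \<Longrightarrow> chain_sum word_aug c = 0"
  by (rule chain_sum_eq_0) (auto simp: cube_pos_chains word_aug_def dest!: bspec split: if_splits,
    metis count_notin nat.distinct(1))

lemma contr_aug [simp]: "chain_sum word_aug (contr0 w) = 0" "chain_sum word_aug (contr1 w) = 0"
  by (rule word_aug_pos_chain[OF contr0_pos], rule word_aug_pos_chain[OF contr1_pos])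

text \<open>The path from the last vertex to itself is empty. Hence the correction term of the
  retraction \<open>G\<close> below vanishes over the last vertex, where the suspended factor is
  placed.\<close>

lemma contr1_last [simp]: "contr1 (replicate n I1) = 0"
  by (induction n) auto

text \<open>
  The chains \<open>cube_path w\<close> realise the suspension of the \<open>n\<close>-cube inside the \<open>Suc n\<close>-cube, between the
  first and the last vertex: a path from the first vertex to \<open>w\<close>, the last edge over \<open>w\<close>, and a path to
  the last vertex.
\<close>

definition cube_path :: "interval list \<Rightarrow> (interval list \<Rightarrow>\<^sub>0 int)" where
  "cube_path w = frag_extend (\<lambda>v. frag_of (v @ [I0])) (contr0 w) + frag_of (w @ [IE])
    + frag_extend (\<lambda>v. frag_of (v @ [I1])) (contr1 w)"

lemma word_bd_snoc:
  "word_bd (w @ [b]) = frag_extend (\<lambda>v. frag_of (v @ [b])) (word_bd w)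
    + (if b = IE then frag_cmul (word_sign w) (frag_of (w @ [I1]) - frag_of (w @ [I0])) else 0)"
  by (simp add: word_bd_append frag_linear)

lemma word_bd_extend_snoc:
  assumes "b \<noteq> IE"
  shows "frag_extend word_bd (frag_extend (\<lambda>v. frag_of (v @ [b])) c) =
    frag_extend (\<lambda>v. frag_of (v @ [b])) (frag_extend word_bd c)"
  using assms by (simp add: word_bd_snoc frag_extend_frag_extend)

text \<open>The signed copies of \<open>w\<close> on the two faces, contributed by the contractions,
  cancel against the ends of the edge over \<open>w\<close>. What remains is the path of the
  boundary and, over a vertex, the two extreme vertices, as for the boundary of a
  suspension.\<close>

lemma cube_path_bd:
  "frag_extend word_bd (cube_path w) = frag_extend cube_path (word_bd w)
    + frag_cmul (word_aug w) (frag_of (replicate (Suc (length w)) I1) - frag_of (replicate (Suc (length w)) I0))"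
proof -
  have snoc: "replicate n b @ [b] = b # replicate n b" for n and b :: interval
    by (simp add: replicate_append_same)
  have "frag_extend cube_path c = frag_extend (\<lambda>v. frag_of (v @ [I0])) (frag_extend contr0 c)
      + frag_extend (\<lambda>v. frag_of (v @ [IE])) c + frag_extend (\<lambda>v. frag_of (v @ [I1])) (frag_extend contr1 c)" for c
    by (simp add: cube_path_def[abs_def] frag_extend_add_fun frag_extend_frag_extend)
  then show ?thesis
    by (simp add: cube_path_def frag_extend_add word_bd_extend_snoc contr0_bd contr1_bd)
       (simp add: word_bd_snoc frag_extend_add frag_extend_diff frag_extend_cmul frag_cmul_diff_right snoc)
qed

lemma cube_path_pos: "cube_path w \<in> pos_chains (cube_adc (Suc (length w))) (Suc (count_list w IE))"
proof -
  have "frag_extend (\<lambda>v. frag_of (v @ [b])) c \<in> pos_chains (cube_adc (Suc n)) i"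
    if "c \<in> pos_chains (cube_adc n) i" "b \<noteq> IE" for b c n i
    using that(1) by (rule pos_chains_frag_extend)
      (use that(2) in \<open>auto simp: cube_adc_basis cube_adc_deg intro!: cube_word_pos\<close>)
  then show ?thesis
    unfolding cube_path_def by (auto intro!: pos_chains_add contr0_pos contr1_pos cube_word_pos)
qed

section \<open>The complexes of the objects of Theta\<close>

text \<open>The value 0 on the empty word makes the recursion for \<open>tree_bd\<close> below yield
  0 on an object \<open>[p]\<close>.\<close>

definition tree_aug :: "nat list \<Rightarrow> int" where
  "tree_aug b = (if length b = 1 then 1 else 0)"

text \<open>
  The word \<open>[i]\<close> stands for the object \<open>i\<close> of \<open>[k](\<theta>\<^sub>1,\<dots>,\<theta>\<^sub>k)\<close>, and \<open>p # b\<close> for the suspension of the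
  generator \<open>b\<close> of \<open>\<theta>\<^sub>p\<^sub>+\<^sub>1\<close>, so that the degree of a word is its length minus one. Only the set of
  words depends on the object of \<open>\<Theta>\<close>; the boundary is the same for all of them. The empty word is junk.
\<close>

primrec tree_bd :: "nat list \<Rightarrow> (nat list \<Rightarrow>\<^sub>0 int)" where
  "tree_bd [] = 0"
| "tree_bd (p # b) = frag_extend (\<lambda>c. frag_of (p # c)) (tree_bd b)
    + frag_cmul (tree_aug b) (frag_of [Suc p] - frag_of [p])"

definition theta_adc :: "nat list set \<Rightarrow> nat list adc" where
  "theta_adc S = \<lparr>basis = S, deg = (\<lambda>b. length b - 1), bd = tree_bd, aug = tree_aug\<rparr>"

definition bracket_basis :: "nat list set list \<Rightarrow> nat list set" where
  "bracket_basis Ss = {[i] | i. i \<le> length Ss} \<union> {p # b | p b. p < length Ss \<and> b \<in> Ss ! p}"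

text \<open>The empty word is excluded because the truncated subtraction in \<open>deg\<close> would
  place it in degree 0, among the objects.\<close>

definition closed_basis :: "nat list set \<Rightarrow> bool" where
  "closed_basis S \<longleftrightarrow> [] \<notin> S \<and> (\<forall>b \<in> S. Poly_Mapping.keys (tree_bd b) \<subseteq> S)"

lemma theta_adc_simps [simp]:
  "basis (theta_adc S) = S" "deg (theta_adc S) b = length b - 1" "bd (theta_adc S) = tree_bd"
  "aug (theta_adc S) = tree_aug"
  by (simp_all add: theta_adc_def)

abbreviation suspend :: "nat \<Rightarrow> (nat list \<Rightarrow>\<^sub>0 int) \<Rightarrow> (nat list \<Rightarrow>\<^sub>0 int)" where
  "suspend p \<equiv> frag_extend (\<lambda>b. frag_of (p # b))"

lemma tree_bd_suspend:
  "frag_extend tree_bd (suspend p c) = suspend p (frag_extend tree_bd c)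
    + frag_cmul (chain_sum tree_aug c) (frag_of [Suc p] - frag_of [p])"
  by (simp add: frag_linear)

lemma keys_suspend: "Poly_Mapping.keys (suspend p c) \<subseteq> (#) p ` Poly_Mapping.keys c"
  using keys_frag_extend[of "\<lambda>b. frag_of (p # b)" c] by (auto simp: keys_frag_of)

lemma closed_bracket_basis:
  assumes "\<And>S. S \<in> set Ss \<Longrightarrow> closed_basis S"
  shows "closed_basis (bracket_basis Ss)"
  unfolding closed_basis_def
proof (intro conjI ballI subsetI)
  show "[] \<notin> bracket_basis Ss" by (simp add: bracket_basis_def)
  fix b v assume "b \<in> bracket_basis Ss" and v: "v \<in> Poly_Mapping.keys (tree_bd b)"
  then consider i where "b = [i]" | p c where "b = p # c" "p < length Ss" "c \<in> Ss ! p"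
    unfolding bracket_basis_def by blast
  then show "v \<in> bracket_basis Ss"
  proof cases
    case 1
    then show ?thesis using v by (simp add: tree_aug_def)
  next
    case 2
    then have "closed_basis (Ss ! p)" using assms by simp
    then have *: "Poly_Mapping.keys (tree_bd c) \<subseteq> Ss ! p" using 2 by (simp add: closed_basis_def)
    have "v \<in> Poly_Mapping.keys (suspend p (tree_bd c)) \<or>
        v \<in> Poly_Mapping.keys (frag_cmul (tree_aug c) (frag_of [Suc p] - frag_of [p]))"
      using v 2(1) keys_add by fastforce
    then consider "v \<in> (#) p ` Poly_Mapping.keys (tree_bd c)" | "v = [Suc p]" | "v = [p]"
      using keys_suspend[of p "tree_bd c"] keys_diff[of "frag_of [Suc p]" "frag_of [p]"]
      by (auto simp: keys_frag_of)
    then show ?thesis using 2 * by cases (auto simp: bracket_basis_def)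
  qed
qed

text \<open>One more suspension is attached at the last object; this is the basis \<open>T\<close>
  of the induction step below.\<close>

lemma bracket_basis_snoc:
  "bracket_basis (Ss @ [S]) = bracket_basis Ss \<union> {[Suc (length Ss)]} \<union> (#) (length Ss) ` S"
proof -
  have "b \<in> bracket_basis (Ss @ [S]) \<longleftrightarrow> b \<in> bracket_basis Ss \<union> {[Suc (length Ss)]} \<union> (#) (length Ss) ` S" for b
    by (auto simp: bracket_basis_def nth_append less_Suc_eq le_Suc_eq)
  then show ?thesis by blast
qed

section \<open>The complexes as retracts of cubes\<close>

lemma cube_chain_bd:
  assumes "\<And>w. w \<in> Poly_Mapping.keys c \<Longrightarrow> length w = n"
  shows "frag_extend (bd (cube_adc n)) c = frag_extend word_bd c"
  by (rule frag_extend_eq) (simp add: assms word_bd_cube)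

lemma adc_map_to_cube:
  "adc_map K (cube_adc n) f \<longleftrightarrow> (\<forall>b \<in> basis K.
     f b \<in> pos_chains (cube_adc n) (deg K b) \<and>
     frag_extend word_bd (f b) = frag_extend f (bd K b) \<and>
     chain_sum word_aug (f b) = aug K b)"
proof -
  have "frag_extend (bd (cube_adc n)) c = frag_extend word_bd c"
    "chain_aug (cube_adc n) c = chain_sum word_aug c" if "c \<in> pos_chains (cube_adc n) i" for c i
    using that by (auto intro!: cube_chain_bd cube_chain_aug simp: cube_pos_chains)
  then show ?thesis unfolding adc_map_def by (metis (no_types, lifting))
qed

lemma adc_map_from_cube:
  "adc_map (cube_adc n) L g \<longleftrightarrow> (\<forall>w. length w = n \<longrightarrow>
     g w \<in> pos_chains L (count_list w IE) \<and>
     frag_extend (bd L) (g w) = frag_extend g (word_bd w) \<and>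
     chain_sum (aug L) (g w) = word_aug w)"
  by (auto simp: adc_map_def cube_adc_basis cube_adc_deg word_bd_cube cube_adc_aug word_aug_def chain_aug_eq)

lemma theta_pos_chains_frag_of: "b \<in> S \<Longrightarrow> length b = Suc i \<Longrightarrow> frag_of b \<in> pos_chains (theta_adc S) i"
  by (rule pos_chains_frag_of) simp_all

lemma theta_pos_chains_mono: "c \<in> pos_chains (theta_adc S) i \<Longrightarrow> S \<subseteq> T \<Longrightarrow> c \<in> pos_chains (theta_adc T) i"
  by (auto simp: pos_chains_def)

text \<open>The induction step on the number of factors: \<open>S\<close> belongs to the bracket on
  the objects from 0 to \<open>k\<close>, and \<open>S'\<close> to the factor to be appended. The
  condition \<open>S_words\<close> keeps the three kinds of words in \<open>T\<close> apart.\<close>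

locale snoc_retract =
  fixes S S' :: "nat list set" and k N n :: nat
    and f g f' g'
  assumes closed: "closed_basis S" "closed_basis S'"
    and S_words: "\<And>b. b \<in> S \<Longrightarrow> (\<exists>i\<le>k. b = [i]) \<or> (\<exists>p<k. \<exists>c. b = p # c)"
    and retract: "adc_retract (theta_adc S) (cube_adc N) f g"
    and retract': "adc_retract (theta_adc S') (cube_adc n) f' g'"
    and ends_in: "[0] \<in> S" "[k] \<in> S"
    and ends: "f [0] = frag_of (replicate N I0)" "f [k] = frag_of (replicate N I1)"
begin

abbreviation "T \<equiv> S \<union> {[Suc k]} \<union> (#) k ` S'"

text \<open>The old bracket lies in the face where the last \<open>Suc n\<close> coordinates are 0.
  The suspended factor runs along the face where the first \<open>N\<close> coordinates are 1, from
  the image of the object \<open>k\<close> to the last vertex.\<close>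

definition "F b =
  (if b \<in> S then frag_extend (\<lambda>u. frag_of (u @ replicate (Suc n) I0)) (f b)
   else if b = [Suc k] then frag_of (replicate (N + Suc n) I1)
   else frag_extend (\<lambda>w. frag_of (replicate N I1 @ w)) (frag_extend cube_path (f' (tl b))))"

text \<open>
  The retraction sends the face where the last coordinate is \<open>1\<close> to the new last vertex, projects the
  face where it is \<open>0\<close> to the first \<open>N\<close> coordinates, and uses \<^const>\<open>contr1\<close> to connect the images of
  the two: the edge from \<open>(u, w, 0)\<close> to \<open>(u, w, 1)\<close> has to start at the image of \<open>u\<close>, so it first follows a
  path to the last vertex of the \<open>N\<close>-cube. Suspended cells survive only over the vertices \<open>u\<close>.
\<close>

definition "G z = (let u = take N z; w = butlast (drop N z) in
  case last z of
    I0 \<Rightarrow> frag_cmul (word_aug w) (g u)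
  | I1 \<Rightarrow> frag_cmul (word_aug u * word_aug w) (frag_of [Suc k])
  | IE \<Rightarrow> frag_cmul (word_aug u) (suspend k (g' w)) + frag_cmul (word_aug w) (frag_extend g (contr1 u)))"

lemma F_simps:
  "b \<in> S \<Longrightarrow> F b = frag_extend (\<lambda>u. frag_of (u @ replicate (Suc n) I0)) (f b)"
  "F [Suc k] = frag_of (replicate (N + Suc n) I1)"
  "b \<in> S' \<Longrightarrow> F (k # b) = frag_extend (\<lambda>w. frag_of (replicate N I1 @ w)) (frag_extend cube_path (f' b))"
proof -
  have "[Suc k] \<notin> S" using S_words by fastforce
  moreover have "k # b \<notin> S \<and> k # b \<noteq> [Suc k]" if "b \<in> S'" for b
    using S_words[of "k # b"] that closed(2) by (auto simp: closed_basis_def)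
  ultimately show "b \<in> S \<Longrightarrow> F b = frag_extend (\<lambda>u. frag_of (u @ replicate (Suc n) I0)) (f b)"
    "F [Suc k] = frag_of (replicate (N + Suc n) I1)"
    "b \<in> S' \<Longrightarrow> F (k # b) = frag_extend (\<lambda>w. frag_of (replicate N I1 @ w)) (frag_extend cube_path (f' b))"
    by (simp_all add: F_def)
qed

lemma G_simps:
  assumes "length u = N"
  shows "G (u @ w @ [I0]) = frag_cmul (word_aug w) (g u)"
    "G (u @ w @ [I1]) = frag_cmul (word_aug u * word_aug w) (frag_of [Suc k])"
    "G (u @ w @ [IE]) = frag_cmul (word_aug u) (suspend k (g' w)) + frag_cmul (word_aug w) (frag_extend g (contr1 u))"
  using assms by (simp_all add: G_def)

lemma fD:
  assumes "b \<in> S"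
  shows "f b \<in> pos_chains (cube_adc N) (length b - 1)" "frag_extend word_bd (f b) = frag_extend f (tree_bd b)"
    "chain_sum word_aug (f b) = tree_aug b" "frag_extend g (f b) = frag_of b"
  using retract assms by (auto simp: adc_retract_def adc_map_to_cube)

lemma f'D:
  assumes "b \<in> S'"
  shows "f' b \<in> pos_chains (cube_adc n) (length b - 1)" "frag_extend word_bd (f' b) = frag_extend f' (tree_bd b)"
    "chain_sum word_aug (f' b) = tree_aug b" "frag_extend g' (f' b) = frag_of b"
  using retract' assms by (auto simp: adc_retract_def adc_map_to_cube)

lemma gD:
  assumes "length w = N"
  shows "g w \<in> pos_chains (theta_adc S) (count_list w IE)" "frag_extend tree_bd (g w) = frag_extend g (word_bd w)"
    "chain_sum tree_aug (g w) = word_aug w"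
  using retract assms by (auto simp: adc_retract_def adc_map_from_cube)

lemma g'D:
  assumes "length w = n"
  shows "g' w \<in> pos_chains (theta_adc S') (count_list w IE)" "frag_extend tree_bd (g' w) = frag_extend g' (word_bd w)"
    "chain_sum tree_aug (g' w) = word_aug w"
  using retract' assms by (auto simp: adc_retract_def adc_map_from_cube)

lemma F_ends: "F [0] = frag_of (replicate (N + Suc n) I0)" "F [Suc k] = frag_of (replicate (N + Suc n) I1)"
  by (simp_all only: F_simps ends_in ends frag_extend_of replicate_add)

lemma F_map: "adc_map (theta_adc T) (cube_adc (N + Suc n)) F"
  unfolding adc_map_to_cube theta_adc_simps
proof
  fix b assume "b \<in> T"
  then consider "b \<in> S" | "b = [Suc k]" | c where "b = k # c" "c \<in> S'" by blast
  then show "F b \<in> pos_chains (cube_adc (N + Suc n)) (length b - 1) \<and>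
    frag_extend word_bd (F b) = frag_extend F (tree_bd b) \<and> chain_sum word_aug (F b) = tree_aug b"
  proof cases
    case 1
    note b = fD[OF 1]
    let ?E = "frag_extend (\<lambda>u. frag_of (u @ replicate (Suc n) I0))"
    have "?E (f b) \<in> pos_chains (cube_adc (N + Suc n)) (length b - 1)"
      using b(1) by (rule pos_chains_frag_extend)
        (auto simp: cube_adc_basis cube_adc_deg count_list_0_iff intro!: cube_word_pos)
    moreover have "frag_extend word_bd (?E (f b)) = frag_extend F (tree_bd b)"
    proof -
      have "frag_extend word_bd (?E (f b)) = ?E (frag_extend word_bd (f b))"
        by (simp add: word_bd_append word_bd_vertex frag_extend_frag_extend del: replicate.simps)
      also have "\<dots> = frag_extend (\<lambda>c. ?E (f c)) (tree_bd b)"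
        by (simp add: b(2) frag_extend_frag_extend del: replicate.simps)
      \<comment> \<open>Closedness of \<open>S\<close> keeps the boundary inside \<open>S\<close>,
        where the first clause of \<open>F\<close> applies.\<close>
      also have "\<dots> = frag_extend F (tree_bd b)"
        using closed(1) 1 by (intro frag_extend_eq) (auto simp: closed_basis_def F_simps(1) subset_iff)
      finally show ?thesis .
    qed
    moreover have "chain_sum word_aug (?E (f b)) = tree_aug b"
      by (simp add: chain_sum_frag_extend b(3))
    ultimately show ?thesis using 1 by (simp only: F_simps)
  next
    case 2
    then show ?thesis
      by (simp only: F_simps tree_bd.simps)
        (auto simp: word_bd_vertex tree_aug_def count_list_0_iff frag_linear intro!: cube_word_pos simp del: replicate.simps)
  next
    case 3
    note c = f'D[OF 3(2)]
    let ?E = "frag_extend (\<lambda>w. frag_of (replicate N I1 @ w))"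
    let ?P = "frag_extend cube_path"
    have len: "length w = n" if "w \<in> Poly_Mapping.keys (f' c)" for w
      using c(1) that by (simp add: cube_pos_chains)
    have c_len: "length c > 0" using closed(2) 3(2) by (auto simp: closed_basis_def)
    have "?E (?P (f' c)) \<in> pos_chains (cube_adc (N + Suc n)) (length c)"
    proof (rule pos_chains_frag_extend[where K = "cube_adc (Suc n)" and i = "length c"])
      show "?P (f' c) \<in> pos_chains (cube_adc (Suc n)) (length c)"
        using c(1)
      proof (rule pos_chains_frag_extend)
        fix w assume "w \<in> basis (cube_adc n)" "deg (cube_adc n) w = length c - 1"
        then show "cube_path w \<in> pos_chains (cube_adc (Suc n)) (length c)"
          using cube_path_pos[of w] c_len by (simp add: cube_adc_basis cube_adc_deg)
      qed
    qed (auto simp: cube_adc_basis cube_adc_deg count_list_0_iff intro!: cube_word_pos)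
    moreover have "frag_extend word_bd (?E (?P (f' c))) = frag_extend F (tree_bd (k # c))"
    proof -
      have "frag_extend word_bd (?E (?P (f' c))) = ?E (frag_extend word_bd (?P (f' c)))"
        by (simp add: word_bd_vertex_append frag_extend_frag_extend)
      also have "frag_extend word_bd (?P (f' c)) = frag_extend (\<lambda>w. frag_extend cube_path (word_bd w)
          + frag_cmul (word_aug w) (frag_of (replicate (Suc n) I1) - frag_of (replicate (Suc n) I0))) (f' c)"
        unfolding frag_extend_frag_extend by (rule frag_extend_eq) (simp add: cube_path_bd len)
      also have "\<dots> = ?P (frag_extend f' (tree_bd c))
          + frag_cmul (tree_aug c) (frag_of (replicate (Suc n) I1) - frag_of (replicate (Suc n) I0))"
        by (simp only: frag_extend_add_fun frag_extend_const_cmul c(3) frag_extend_frag_extend[symmetric] c(2))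
      \<comment> \<open>Prefixing \<open>N\<close> letters \<open>I1\<close> turns the extreme
        vertices of the last \<open>Suc n\<close> coordinates into \<open>F [Suc k]\<close> and, as
        \<open>f [k]\<close> is the last vertex of the \<open>N\<close>-cube,
        \<open>F [k]\<close>.\<close>
      also have "?E \<dots> = frag_extend (\<lambda>d. ?E (?P (f' d))) (tree_bd c) + frag_cmul (tree_aug c) (F [Suc k] - F [k])"
        by (simp only: F_simps ends_in ends frag_extend_of frag_extend_add frag_extend_diff frag_extend_cmul
            frag_extend_frag_extend replicate_add)
      also have "frag_extend (\<lambda>d. ?E (?P (f' d))) (tree_bd c) = frag_extend (\<lambda>d. F (k # d)) (tree_bd c)"
        using closed(2) 3 by (intro frag_extend_eq) (auto simp: closed_basis_def F_simps(3) subset_iff)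
      also have "frag_extend (\<lambda>d. F (k # d)) (tree_bd c) + frag_cmul (tree_aug c) (F [Suc k] - F [k]) =
          frag_extend F (tree_bd (k # c))"
        by (simp add: frag_extend_add frag_extend_diff frag_extend_cmul frag_extend_frag_extend)
      finally show ?thesis .
    qed
    moreover have "chain_sum word_aug (?E (?P (f' c))) = tree_aug (k # c)"
    proof -
      have "chain_sum word_aug (cube_path w) = 0" for w
        by (rule word_aug_pos_chain[OF cube_path_pos])
      then show ?thesis using c_len by (simp add: chain_sum_frag_extend tree_aug_def chain_sum_eq_0)
    qed
    ultimately show ?thesis using 3 by (simp add: F_simps del: tree_bd.simps)
  qed
qed

lemma G_map: "adc_map (cube_adc (N + Suc n)) (theta_adc T) G"
  unfolding adc_map_from_cube theta_adc_simps
proof (intro allI impI)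
  fix z :: "interval list" assume z: "length z = N + Suc n"
  define u where "u = take N z"
  define w where "w = butlast (drop N z)"
  define b where "b = last z"
  have u: "length u = N" and w: "length w = n" and zd: "z = u @ w @ [b]"
  proof -
    have b: "last (drop N z) = b" using z by (simp add: b_def)
    have "drop N z \<noteq> []" using z by simp
    from append_butlast_last_id[OF this] have d: "drop N z = w @ [b]" unfolding b w_def by (rule sym)
    show "z = u @ w @ [b]" unfolding d[symmetric] u_def by (rule append_take_drop_id[symmetric])
    show "length u = N" "length w = n" unfolding u_def w_def using z by simp_all
  qed
  have gS: "c \<in> pos_chains (theta_adc T) i" if "c \<in> pos_chains (theta_adc S) i" for c i
    by (rule theta_pos_chains_mono[OF that]) blast
  have contr1_len: "length v = N" "count_list v IE = Suc (count_list u IE)" if "v \<in> Poly_Mapping.keys (contr1 u)" for v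
    using contr1_pos[of u] that u by (auto simp: cube_pos_chains)
  have bd_u: "frag_extend h (word_bd u) = frag_extend h' (word_bd u)" if "\<And>v. length v = N \<Longrightarrow> h v = h' v" for h h' :: "_ \<Rightarrow> nat list \<Rightarrow>\<^sub>0 int"
    using that u by (intro frag_extend_word_bd_length) simp
  \<comment> \<open>The contraction ends at the last vertex, which \<open>g\<close> sends to
    \<open>[k]\<close> because it equals \<open>f [k]\<close> and \<open>g\<close> is a left inverse
    of \<open>f\<close>.\<close>
  have contr: "frag_extend tree_bd (frag_extend g (contr1 u)) = frag_extend g (frag_extend contr1 (word_bd u))
      - frag_cmul (word_sign u) (g u) + frag_cmul (word_aug u) (frag_of [k])"
  proof -
    have "frag_extend tree_bd (frag_extend g (contr1 u)) = frag_extend g (frag_extend word_bd (contr1 u))"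
      unfolding frag_extend_frag_extend by (rule frag_extend_eq) (simp add: gD contr1_len)
    then show ?thesis
      using fD(4)[OF ends_in(2)] by (simp add: contr1_bd u ends frag_extend_add frag_extend_diff frag_extend_cmul)
  qed
  have z_bd: "frag_extend G (word_bd z) = frag_extend (\<lambda>u'. G (u' @ w @ [b])) (word_bd u)
      + frag_cmul (word_sign u) (frag_extend (\<lambda>w'. G (u @ w' @ [b])) (word_bd w)
        + (if b = IE then frag_cmul (word_sign w) (G (u @ w @ [I1]) - G (u @ w @ [I0])) else 0))"
    unfolding zd word_bd_append[of u] word_bd_snoc[of w]
    by (simp add: frag_linear)
  show "G z \<in> pos_chains (theta_adc T) (count_list z IE) \<and>
    frag_extend tree_bd (G z) = frag_extend G (word_bd z) \<and> chain_sum tree_aug (G z) = word_aug z"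
  proof (cases b)
    case I0
    have "frag_extend tree_bd (G z) = frag_extend G (word_bd z)"
      unfolding z_bd unfolding zd I0
      by (subst bd_u[of _ "\<lambda>u'. frag_cmul (word_aug w) (g u')"]) (simp_all add: G_simps u frag_linear gD)
    moreover have "G z \<in> pos_chains (theta_adc T) (count_list z IE)"
      using gS[OF gD(1)[OF u]] unfolding zd I0
      by (auto simp: G_simps u word_aug_def pos_chains_0 count_list_0_iff)
    ultimately show ?thesis unfolding zd I0 by (simp add: G_simps u gD)
  next
    case I1
    have "frag_extend tree_bd (G z) = frag_extend G (word_bd z)"
      unfolding z_bd unfolding zd I1
      by (subst bd_u[of _ "\<lambda>u'. frag_cmul (word_aug u') (frag_cmul (word_aug w) (frag_of [Suc k]))"])
         (simp_all add: G_simps u frag_linear tree_aug_def frag_extend_const_cmul)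
    moreover have "G z \<in> pos_chains (theta_adc T) (count_list z IE)"
      unfolding zd I1
      by (auto simp: G_simps u word_aug_def pos_chains_0 count_list_0_iff intro!: theta_pos_chains_frag_of)
    ultimately show ?thesis unfolding zd I1 by (simp add: G_simps u tree_aug_def)
  next
    case IE
    have "frag_extend tree_bd (G z) = frag_cmul (word_aug u) (suspend k (frag_extend g' (word_bd w))
        + frag_cmul (word_aug w) (frag_of [Suc k] - frag_of [k]))
      + frag_cmul (word_aug w) (frag_extend g (frag_extend contr1 (word_bd u))
        - frag_cmul (word_sign u) (g u) + frag_cmul (word_aug u) (frag_of [k]))"
      unfolding zd IE G_simps(3)[OF u] by (simp only: frag_extend_add frag_extend_cmul tree_bd_suspend contr g'D w)
    moreover have "frag_extend (\<lambda>u'. G (u' @ w @ [b])) (word_bd u) =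
        frag_cmul (word_aug w) (frag_extend g (frag_extend contr1 (word_bd u)))"
    proof -
      have "frag_extend (\<lambda>u'. G (u' @ w @ [b])) (word_bd u) = frag_extend (\<lambda>u'. frag_cmul (word_aug u')
          (suspend k (g' w)) + frag_cmul (word_aug w) (frag_extend g (contr1 u'))) (word_bd u)"
        by (rule bd_u) (simp add: IE G_simps)
      then show ?thesis
        by (simp add: frag_extend_add_fun frag_extend_cmul_fun frag_extend_const_cmul frag_extend_frag_extend)
    qed
    moreover have "frag_extend (\<lambda>w'. G (u @ w' @ [b])) (word_bd w) =
        frag_cmul (word_aug u) (suspend k (frag_extend g' (word_bd w)))"
      by (simp add: IE G_simps u frag_extend_add_fun frag_extend_cmul_fun frag_extend_const_cmul frag_extend_frag_extend)
    \<comment> \<open>The two terms \<open>[k]\<close>, one from the suspension and one from the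
      contraction, cancel. The remaining signs agree because \<open>word_aug\<close> is nonzero only
      on vertices, and these have sign 1.\<close>
    ultimately have "frag_extend tree_bd (G z) = frag_extend G (word_bd z)"
      unfolding z_bd using IE
      by (cases "IE \<in> set u"; cases "IE \<in> set w")
        (simp_all add: G_simps u word_aug_def word_sign_def frag_cmul_distrib2 frag_cmul_diff_right count_list_0_iff)
    moreover have "G z \<in> pos_chains (theta_adc T) (count_list z IE)"
    proof -
      have "suspend k (g' w) \<in> pos_chains (theta_adc T) (Suc (count_list w IE))"
        using g'D(1)[OF w]
      proof (rule pos_chains_frag_extend)
        fix b assume "b \<in> basis (theta_adc S')" "deg (theta_adc S') b = count_list w IE"
        moreover from this have "b \<noteq> []" using closed(2) by (auto simp: closed_basis_def)
        ultimately show "frag_of (k # b) \<in> pos_chains (theta_adc T) (Suc (count_list w IE))"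
          by (intro theta_pos_chains_frag_of) (auto simp: neq_Nil_conv)
      qed
      moreover have "frag_extend g (contr1 u) \<in> pos_chains (theta_adc T) (Suc (count_list u IE))"
        using contr1_pos[of u]
      proof (rule pos_chains_frag_extend)
        fix v assume "v \<in> basis (cube_adc (length u))" "deg (cube_adc (length u)) v = Suc (count_list u IE)"
        then show "g v \<in> pos_chains (theta_adc T) (Suc (count_list u IE))"
          using gS[OF gD(1)[of v]] u by (simp only: cube_adc_basis cube_adc_deg mem_Collect_eq)
      qed
      ultimately show ?thesis
        unfolding zd IE
        by (auto simp: G_simps u word_aug_def pos_chains_0 count_list_0_iff intro!: pos_chains_add)
    qed
    moreover have "chain_sum tree_aug (G z) = word_aug z"
    proof -
      have "chain_sum tree_aug (suspend k (g' w)) = 0"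
        unfolding chain_sum_frag_extend
        using g'D(1)[OF w] closed(2) by (intro chain_sum_eq_0) (auto simp: pos_chains_def closed_basis_def tree_aug_def)
      moreover have "chain_sum tree_aug (frag_extend g (contr1 u)) = 0"
        unfolding chain_sum_frag_extend
      proof (rule chain_sum_eq_0)
        fix v assume v: "v \<in> Poly_Mapping.keys (contr1 u)"
        then have "IE \<in> set v" using contr1_len(2)[OF v] count_notin[of IE v] by fastforce
        then show "chain_sum tree_aug (g v) = 0" using contr1_len(1)[OF v] by (simp add: gD word_aug_def)
      qed
      ultimately show ?thesis unfolding zd IE by (simp add: G_simps u)
    qed
    ultimately show ?thesis by blast
  qed
qed

lemma GF:
  assumes "b \<in> T" shows "frag_extend G (F b) = frag_of b"
proof -
  consider "b \<in> S" | "b = [Suc k]" | c where "b = k # c" "c \<in> S'" using assms by blast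
  then show ?thesis
  proof cases
    case 1
    have "replicate (Suc n) I0 = replicate n I0 @ [I0]" by (simp add: replicate_append_same)
    then have "frag_extend G (F b) = frag_extend (\<lambda>u. G (u @ replicate n I0 @ [I0])) (f b)"
      by (simp only: F_simps 1 frag_extend_frag_extend frag_extend_of)
    also have "\<dots> = frag_extend g (f b)"
      using fD(1)[OF 1] by (intro frag_extend_eq) (simp add: G_simps cube_pos_chains)
    finally show ?thesis by (simp add: fD 1)
  next
    case 2
    have "replicate (N + Suc n) I1 = replicate N I1 @ replicate n I1 @ [I1]" by (simp add: replicate_append_same replicate_add)
    then show ?thesis by (simp only: 2 F_simps frag_extend_of) (simp add: G_simps)
  next
    case 3
    have c: "frag_extend g' (f' c) = frag_of c" using f'D 3 by blast
    have "frag_extend G (F b) = frag_extend (\<lambda>w. frag_extend (\<lambda>v. G (replicate N I1 @ v)) (cube_path w)) (f' c)"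
      by (simp only: F_simps 3 frag_extend_frag_extend frag_extend_of)
    \<comment> \<open>The contraction parts of \<open>cube_path\<close> lie on the faces where
      \<open>G\<close> multiplies by an augmentation, which is 0 on them. Only the edge over
      \<open>w\<close> survives, and its correction term vanishes at the last vertex.\<close>
    also have "\<dots> = frag_extend (\<lambda>w. suspend k (g' w)) (f' c)"
      by (rule frag_extend_eq)
        (simp add: cube_path_def frag_linear G_simps frag_extend_const_cmul)
    finally show ?thesis by (simp only: c frag_extend_frag_extend[symmetric] frag_extend_of 3)
  qed
qed

lemma retract_snoc: "adc_retract (theta_adc T) (cube_adc (N + Suc n)) F G"
  using F_map G_map GF by (simp add: adc_retract_def)

end

section \<open>Objects of Theta as omega-categories of complexes\<close>

text \<open>A left inverse of \<open>suspend p\<close>. It is applied in positive degree, since it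
  would send the object \<open>[p]\<close> to the empty word.\<close>

abbreviation component :: "nat \<Rightarrow> (nat list \<Rightarrow>\<^sub>0 int) \<Rightarrow> (nat list \<Rightarrow>\<^sub>0 int)" where
  "component p \<equiv> Poly_Mapping.map_key ((#) p)"

lemma lookup_component [simp]: "Poly_Mapping.lookup (component p c) b = Poly_Mapping.lookup c (p # b)"
  by (simp add: map_key.rep_eq)

lemma keys_component: "Poly_Mapping.keys (component p c) = {b. p # b \<in> Poly_Mapping.keys c}"
  by (auto simp: in_keys_iff)

lemma lookup_suspend [simp]:
  "Poly_Mapping.lookup (suspend p c) (q # b) = (if p = q then Poly_Mapping.lookup c b else 0)"
  "Poly_Mapping.lookup (suspend p c) [] = 0"
proof -
  have "Poly_Mapping.lookup (suspend p c) (q # b) = (if p = q then Poly_Mapping.lookup c b else 0)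
      \<and> Poly_Mapping.lookup (suspend p c) [] = 0"
    by (rule frag_induction[of c UNIV]) (auto simp: frag_extend_diff lookup_minus)
  then show "Poly_Mapping.lookup (suspend p c) (q # b) = (if p = q then Poly_Mapping.lookup c b else 0)"
    "Poly_Mapping.lookup (suspend p c) [] = 0" by blast+
qed

lemma component_linear [simp]:
  "component p (c - d) = component p c - component p d"
  "component p (c + d) = component p c + component p d"
  "component p 0 = 0"
  by (auto intro!: poly_mapping_eqI simp: lookup_minus lookup_add)

lemma component_suspend [simp]: "component q (suspend p c) = (if p = q then c else 0)"
  by (auto intro!: poly_mapping_eqI)

lemma component_sum: "component q (\<Sum>i\<in>I. c i) = (\<Sum>i\<in>I. component q (c i))"
  by (induction I rule: infinite_finite_induct) auto

lemma component_sum_suspend: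
  assumes "i \<le> q" "q < i + m"
  shows "component q (\<Sum>p<m. suspend (i + p) (d p)) = d (q - i)"
proof -
  have "component q (\<Sum>p<m. suspend (i + p) (d p)) = (\<Sum>p<m. if p = q - i then d p else 0)"
    unfolding component_sum using assms by (intro sum.cong) auto
  moreover have "q - i < m" using assms by linarith
  ultimately show ?thesis by simp
qed

section \<open>Positive chains of a bracket and their augmentation\<close>

lemma theta_pos_chainsD:
  assumes "c \<in> pos_chains (theta_adc S) n"
  shows "b \<in> Poly_Mapping.keys c \<Longrightarrow> b \<in> S" "b \<in> Poly_Mapping.keys c \<Longrightarrow> length b - 1 = n"
    "Poly_Mapping.lookup c b \<ge> 0"
  using assms by (auto simp: pos_chains_def)

lemma suspend_pos:
  assumes "c \<in> pos_chains (theta_adc (Ss ! p)) n" "p < length Ss" "[] \<notin> Ss ! p"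
  shows "suspend p c \<in> pos_chains (theta_adc (bracket_basis Ss)) (Suc n)"
  using assms(1)
proof (rule pos_chains_frag_extend)
  fix b assume "b \<in> basis (theta_adc (Ss ! p))" "deg (theta_adc (Ss ! p)) b = n"
  then show "frag_of (p # b) \<in> pos_chains (theta_adc (bracket_basis Ss)) (Suc n)"
    using assms by (cases b) (auto intro!: theta_pos_chains_frag_of simp: bracket_basis_def)
qed

lemma component_pos:
  assumes "c \<in> pos_chains (theta_adc (bracket_basis Ss)) (Suc n)" "p < length Ss"
  shows "component p c \<in> pos_chains (theta_adc (Ss ! p)) n"
proof -
  have "b \<in> Ss ! p \<and> length b - 1 = n" if "p # b \<in> Poly_Mapping.keys c" for b
    using theta_pos_chainsD(1,2)[OF assms(1) that] by (auto simp: bracket_basis_def)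
  then show ?thesis
    using theta_pos_chainsD(3)[OF assms(1)] by (auto simp: pos_chains_def keys_component)
qed

text \<open>A generator of positive degree is not an object, so it is suspended from exactly one
  factor, the one named by its first letter.\<close>

lemma suspend_decomposition:
  assumes "c \<in> pos_chains (theta_adc (bracket_basis Ss)) (Suc n)"
  shows "c = (\<Sum>p<length Ss. suspend p (component p c))"
proof (rule poly_mapping_eqI)
  fix b
  show "Poly_Mapping.lookup c b = Poly_Mapping.lookup (\<Sum>p<length Ss. suspend p (component p c)) b"
  proof (cases b)
    case Nil
    then have "b \<notin> Poly_Mapping.keys c" using theta_pos_chainsD(2)[OF assms, of b] by auto
    then show ?thesis by (simp add: Nil lookup_sum in_keys_iff)
  next
    case (Cons q d)
    have "q < length Ss" if "b \<in> Poly_Mapping.keys c"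
      using theta_pos_chainsD(1,2)[OF assms that] Cons by (auto simp: bracket_basis_def)
    then show ?thesis by (auto simp: Cons lookup_sum in_keys_iff)
  qed
qed

lemma theta_bd_degree_0:
  assumes "c \<in> pos_chains (theta_adc S) 0" shows "frag_extend tree_bd c = 0"
proof (rule frag_extend_eq_0)
  fix b assume "b \<in> Poly_Mapping.keys c"
  then have "length b \<le> 1" using theta_pos_chainsD(2)[OF assms] by fastforce
  then show "tree_bd b = 0" by (cases b) (auto simp: tree_aug_def)
qed

lemma theta_aug_pos_degree:
  assumes "c \<in> pos_chains (theta_adc S) (Suc n)" shows "chain_sum tree_aug c = 0"
  using theta_pos_chainsD(2)[OF assms] by (intro chain_sum_eq_0) (fastforce simp: tree_aug_def)

lemma theta_aug_degree_0:
  assumes "c \<in> pos_chains (theta_adc S) 0" "[] \<notin> S"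
  shows "chain_sum tree_aug c = (\<Sum>b\<in>Poly_Mapping.keys c. Poly_Mapping.lookup c b)"
  unfolding chain_sum_def
proof (rule sum.cong)
  fix b assume "b \<in> Poly_Mapping.keys c"
  then have "length b = 1" using theta_pos_chainsD(1,2)[OF assms(1)] assms(2) by (cases b) fastforce+
  then show "Poly_Mapping.lookup c b * tree_aug b = Poly_Mapping.lookup c b" by (simp add: tree_aug_def)
qed simp

lemma theta_aug_nonneg:
  assumes "c \<in> pos_chains (theta_adc S) n" shows "chain_sum tree_aug c \<ge> 0"
  unfolding chain_sum_def using theta_pos_chainsD(3)[OF assms] by (intro sum_nonneg) (simp add: tree_aug_def)

lemma theta_aug_0_imp_0:
  assumes c: "c \<in> pos_chains (theta_adc S) 0" "[] \<notin> S" and "chain_sum tree_aug c = 0"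
  shows "c = 0"
proof -
  have "(\<Sum>b\<in>Poly_Mapping.keys c. Poly_Mapping.lookup c b) = 0" using assms theta_aug_degree_0 by metis
  then have "\<forall>b\<in>Poly_Mapping.keys c. Poly_Mapping.lookup c b = 0"
    using theta_pos_chainsD(3)[OF c(1)] by (subst (asm) sum_nonneg_eq_0_iff) auto
  then show ?thesis by (intro poly_mapping_eqI) (auto simp: in_keys_iff)
qed

text \<open>Removing one generator that occurs leaves a positive chain of augmentation 0, hence
  nothing.\<close>

lemma theta_aug_1_imp_frag_of:
  assumes c: "c \<in> pos_chains (theta_adc S) 0" "[] \<notin> S" and 1: "chain_sum tree_aug c = 1"
  shows "\<exists>i. [i] \<in> S \<and> c = frag_of [i]"
proof -
  have "c \<noteq> 0" using 1 by auto
  then have "Poly_Mapping.keys c \<noteq> {}" by simp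
  then obtain b where b: "b \<in> Poly_Mapping.keys c" by blast
  then have "b \<in> S" "length b - 1 = 0" using theta_pos_chainsD(1,2)[OF c(1)] by auto
  then obtain i where i: "b = [i]" using c(2) by (cases b) auto
  have "Poly_Mapping.lookup c b \<ge> 1" using b theta_pos_chainsD(3)[OF c(1), of b] by (simp add: in_keys_iff)
  have "c - frag_of b \<in> pos_chains (theta_adc S) 0"
    using c(1) b keys_diff[of c "frag_of b"] \<open>Poly_Mapping.lookup c b \<ge> 1\<close>
    by (auto simp: pos_chains_def lookup_minus subset_iff keys_frag_of)
  moreover have "chain_sum tree_aug (c - frag_of b) = 0" using 1 i by (simp add: tree_aug_def)
  ultimately have "c - frag_of b = 0" using c(2) by (intro theta_aug_0_imp_0)
  then show ?thesis using i \<open>b \<in> S\<close> by auto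
qed

lemma telescope_lookup:
  "Poly_Mapping.lookup (\<Sum>p<k. frag_cmul (a p) (frag_of [Suc p] - frag_of [p])) [q] =
    (if 0 < q \<and> q \<le> k then a (q - 1) else 0) - (if q < k then a q else 0)"
  by (induction k) (auto simp: lookup_add lookup_minus less_Suc_eq le_Suc_eq)

text \<open>The edges from \<open>p\<close> to \<open>Suc p\<close> form a line, so a chain on them
  is determined by its boundary: it is the signed path from \<open>i\<close> to \<open>j\<close>.
  The coefficients are read off successively from vertex 0 onwards.\<close>

lemma telescope_unique:
  assumes "(\<Sum>p<k. frag_cmul (a p) (frag_of [Suc p] - frag_of [p])) = frag_of [j] - frag_of [i]"
    and "q < k"
  shows "a q = of_bool (i \<le> q) - of_bool (j \<le> q)"
  using assms(2)
proof (induction q)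
  case 0
  then show ?case using arg_cong[OF assms(1), of "\<lambda>c. Poly_Mapping.lookup c [0]"]
    unfolding telescope_lookup by (auto simp: lookup_minus of_bool_def split: if_splits)
next
  case (Suc q)
  then show ?case using arg_cong[OF assms(1), of "\<lambda>c. Poly_Mapping.lookup c [Suc q]"]
    unfolding telescope_lookup by (auto simp: lookup_minus of_bool_def split: if_splits)
qed

text \<open>Positivity matters here: the difference of two parallel edges is a nonzero
  cycle.\<close>

definition acyclic_basis :: "nat list set \<Rightarrow> bool" where
  "acyclic_basis S \<longleftrightarrow>
    (\<forall>n. \<forall>c \<in> pos_chains (theta_adc S) (Suc n). frag_extend tree_bd c = 0 \<longrightarrow> c = 0)"

context
  fixes Ss :: "nat list set list"
  assumes closed: "\<And>p. p < length Ss \<Longrightarrow> closed_basis (Ss ! p)"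
begin

lemma nil_notin: "p < length Ss \<Longrightarrow> [] \<notin> Ss ! p"
  using closed by (simp add: closed_basis_def)

lemma bracket_bd_1:
  assumes "c \<in> pos_chains (theta_adc (bracket_basis Ss)) (Suc 0)"
  shows "frag_extend tree_bd c =
    (\<Sum>p<length Ss. frag_cmul (chain_sum tree_aug (component p c)) (frag_of [Suc p] - frag_of [p]))"
proof -
  have "frag_extend tree_bd c = (\<Sum>p<length Ss. frag_extend tree_bd (suspend p (component p c)))"
    by (subst suspend_decomposition[OF assms]) (simp add: frag_extend_sum o_def)
  also have "\<dots> = (\<Sum>p<length Ss. frag_cmul (chain_sum tree_aug (component p c)) (frag_of [Suc p] - frag_of [p]))"
    by (rule sum.cong) (simp_all add: tree_bd_suspend theta_bd_degree_0[OF component_pos[OF assms]])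
  finally show ?thesis .
qed

text \<open>From degree 2 on, the components have positive degree, so the augmentation term in the
  boundary of a suspension vanishes.\<close>

lemma component_bd:
  assumes "c \<in> pos_chains (theta_adc (bracket_basis Ss)) (Suc (Suc n))" "q < length Ss"
  shows "component q (frag_extend tree_bd c) = frag_extend tree_bd (component q c)"
proof -
  have "frag_extend tree_bd c = (\<Sum>p<length Ss. frag_extend tree_bd (suspend p (component p c)))"
    by (subst suspend_decomposition[OF assms(1)]) (simp add: frag_extend_sum o_def)
  also have "\<dots> = (\<Sum>p<length Ss. suspend p (frag_extend tree_bd (component p c)))"
    by (rule sum.cong) (simp_all add: tree_bd_suspend theta_aug_pos_degree[OF component_pos[OF assms(1)]])
  finally show ?thesis
    using component_sum_suspend[of 0 q "length Ss" "\<lambda>p. frag_extend tree_bd (component p c)"] assms(2) by simp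
qed

lemma acyclic_bracket_basis:
  assumes "\<And>p. p < length Ss \<Longrightarrow> acyclic_basis (Ss ! p)"
  shows "acyclic_basis (bracket_basis Ss)"
  unfolding acyclic_basis_def
proof (intro allI ballI impI)
  fix n c assume c: "c \<in> pos_chains (theta_adc (bracket_basis Ss)) (Suc n)" and 0: "frag_extend tree_bd c = 0"
  have "component p c = 0" if p: "p < length Ss" for p
  proof (cases n)
    case 0
    \<comment> \<open>A cycle of degree 1 is treated as a path from 0 to 0, so all its coefficients
      along the line vanish; positivity then kills the components.\<close>
    have "(\<Sum>p<length Ss. frag_cmul (chain_sum tree_aug (component p c)) (frag_of [Suc p] - frag_of [p])) =
        frag_of [0] - frag_of [0]"
      using bracket_bd_1 c \<open>n = 0\<close> \<open>frag_extend tree_bd c = 0\<close> by simp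
    from telescope_unique[OF this p] have "chain_sum tree_aug (component p c) = 0" by simp
    then show ?thesis
      using component_pos[OF c p] nil_notin[OF p] \<open>n = 0\<close> by (intro theta_aug_0_imp_0) auto
  next
    case (Suc m)
    have "frag_extend tree_bd (component p c) = 0"
      using component_bd[of c m p] c p 0 Suc by simp
    then show ?thesis using assms[OF p] component_pos[OF c p] Suc by (auto simp: acyclic_basis_def)
  qed
  then show "c = 0" by (subst suspend_decomposition[OF c]) simp
qed

end

text \<open>The comparison with \<nu>, given on all of \<open>tcell\<close> at once since the words
  do not depend on the object of \<Theta>. The chains in degree 0 record the end points; entry
  \<open>p\<close> of the tuple, counted from 0, belongs to the edge from \<open>i + p\<close> to
  \<open>i + p + 1\<close>, and suspension raises its degree by one.\<close>

primrec theta_cell :: "tcell \<Rightarrow> nat list nu_cell" where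
  "theta_cell (TCell i j xs) = (\<lambda>n \<alpha>. case n of
     0 \<Rightarrow> frag_of [if \<alpha> then j else i]
   | Suc m \<Rightarrow> \<Sum>p<length xs. suspend (i + p) ((map theta_cell xs ! p) m \<alpha>))"

declare theta_cell.simps [simp del]

lemma theta_cell_simps [simp]:
  "theta_cell (TCell i j xs) 0 \<alpha> = frag_of [if \<alpha> then j else i]"
  "theta_cell (TCell i j xs) (Suc m) \<alpha> = (\<Sum>p<length xs. suspend (i + p) (theta_cell (xs ! p) m \<alpha>))"
  by (simp_all add: theta_cell.simps)

lemma sum_lessThan_add: "(\<Sum>p<m + n. f p) = (\<Sum>p<m. f p) + (\<Sum>p<n. f (m + p))"
  for f :: "nat \<Rightarrow> 'b::comm_monoid_add"
  by (induction n) (simp_all add: add.assoc)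

lemma hom_ocat_nth:
  assumes "i \<le> j" "j \<le> length \<theta>s"
  shows "xs \<in> cells (hom_ocat \<theta>s i j) \<longleftrightarrow> length xs = j - i \<and> (\<forall>p<j - i. xs ! p \<in> cells (\<theta>s ! (i + p)))"
    "length xs = j - i \<Longrightarrow> length (src (hom_ocat \<theta>s i j) n xs) = j - i"
    "length xs = j - i \<Longrightarrow> length (tgt (hom_ocat \<theta>s i j) n xs) = j - i"
    "length xs = j - i \<Longrightarrow> length ys = j - i \<Longrightarrow> length (ocomp (hom_ocat \<theta>s i j) n xs ys) = j - i"
    "length xs = j - i \<Longrightarrow> p < j - i \<Longrightarrow> src (hom_ocat \<theta>s i j) n xs ! p = src (\<theta>s ! (i + p)) n (xs ! p)"
    "length xs = j - i \<Longrightarrow> p < j - i \<Longrightarrow> tgt (hom_ocat \<theta>s i j) n xs ! p = tgt (\<theta>s ! (i + p)) n (xs ! p)"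
    "length xs = j - i \<Longrightarrow> length ys = j - i \<Longrightarrow> p < j - i \<Longrightarrow>
      ocomp (hom_ocat \<theta>s i j) n xs ys ! p = ocomp (\<theta>s ! (i + p)) n (xs ! p) (ys ! p)"
proof -
  have "min (length \<theta>s - i) (j - i) = j - i" using assms by simp
  moreover have "take (j - i) (drop i \<theta>s) ! p = \<theta>s ! (i + p)" if "p < j - i" for p using assms that by simp
  ultimately show "xs \<in> cells (hom_ocat \<theta>s i j) \<longleftrightarrow> length xs = j - i \<and> (\<forall>p<j - i. xs ! p \<in> cells (\<theta>s ! (i + p)))"
    "length xs = j - i \<Longrightarrow> length (src (hom_ocat \<theta>s i j) n xs) = j - i"
    "length xs = j - i \<Longrightarrow> length (tgt (hom_ocat \<theta>s i j) n xs) = j - i"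
    "length xs = j - i \<Longrightarrow> length ys = j - i \<Longrightarrow> length (ocomp (hom_ocat \<theta>s i j) n xs ys) = j - i"
    "length xs = j - i \<Longrightarrow> p < j - i \<Longrightarrow> src (hom_ocat \<theta>s i j) n xs ! p = src (\<theta>s ! (i + p)) n (xs ! p)"
    "length xs = j - i \<Longrightarrow> p < j - i \<Longrightarrow> tgt (hom_ocat \<theta>s i j) n xs ! p = tgt (\<theta>s ! (i + p)) n (xs ! p)"
    "length xs = j - i \<Longrightarrow> length ys = j - i \<Longrightarrow> p < j - i \<Longrightarrow>
      ocomp (hom_ocat \<theta>s i j) n xs ys ! p = ocomp (\<theta>s ! (i + p)) n (xs ! p) (ys ! p)"
    by (simp_all add: hom_ocat_def prod_cells)
qed

lemma nu_src_tgt: "src (nu K) = nu_trunc False" "tgt (nu K) = nu_trunc True"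
  by (simp_all add: nu_def)

text \<open>The induction hypothesis: \<open>theta_cell\<close> identifies \<theta> with the
  \<omega>-category of the complex, and the basis has the closure and acyclicity used at the next
  level.\<close>

definition models :: "tcell ocat \<Rightarrow> nat list set \<Rightarrow> bool" where
  "models \<theta> S \<longleftrightarrow> closed_basis S \<and> acyclic_basis S \<and> strict_functor \<theta> (nu (theta_adc S)) theta_cell \<and>
    bij_betw theta_cell (cells \<theta>) (cells (nu (theta_adc S)))"

lemma theta_nu_cellI:
  assumes "\<And>i \<alpha>. x i \<alpha> \<in> pos_chains (theta_adc S) i" "\<exists>N. \<forall>i\<ge>N. \<forall>\<alpha>. x i \<alpha> = 0"
    "\<And>\<alpha>. chain_sum tree_aug (x 0 \<alpha>) = 1"
    "\<And>i \<alpha>. frag_extend tree_bd (x (Suc i) \<alpha>) = x i True - x i False"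
  shows "x \<in> cells (nu (theta_adc S))"
  using assms by (simp add: nu_def chain_aug_eq)

lemma theta_nu_cellD:
  assumes "x \<in> cells (nu (theta_adc S))"
  shows "x i \<alpha> \<in> pos_chains (theta_adc S) i" "\<exists>N. \<forall>i\<ge>N. \<forall>\<alpha>. x i \<alpha> = 0"
    "chain_sum tree_aug (x 0 \<alpha>) = 1"
    "frag_extend tree_bd (x (Suc i) \<alpha>) = x i True - x i False"
  using assms by (simp_all add: nu_def chain_aug_eq)

section \<open>The comparison functor of a bracket is an isomorphism\<close>

context
  fixes \<theta>s :: "tcell ocat list" and Ss :: "nat list set list"
  assumes len: "length Ss = length \<theta>s"
    and models: "\<And>p. p < length \<theta>s \<Longrightarrow> models (\<theta>s ! p) (Ss ! p)"
begin

lemma factor_closed: "p < length Ss \<Longrightarrow> closed_basis (Ss ! p)"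
  using models len by (simp add: models_def)

lemma factor_functor: "p < length \<theta>s \<Longrightarrow> strict_functor (\<theta>s ! p) (nu (theta_adc (Ss ! p))) theta_cell"
  using models by (simp add: models_def)

lemma factor_cell: "p < length \<theta>s \<Longrightarrow> x \<in> cells (\<theta>s ! p) \<Longrightarrow> theta_cell x \<in> cells (nu (theta_adc (Ss ! p)))"
  using factor_functor by (simp add: strict_functor_def)

lemma factor_strict: "\<theta> \<in> set \<theta>s \<Longrightarrow> strict_omega_category \<theta>"
  using factor_functor by (auto simp: in_set_conv_nth strict_functor_def)

lemma bracket_theta_cell:
  assumes "c \<in> cells (bracket \<theta>s)"
  shows "theta_cell c \<in> cells (nu (theta_adc (bracket_basis Ss)))"
proof -
  obtain i j xs where c: "c = TCell i j xs" by (cases c)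
  have ij: "i \<le> j" "j \<le> length \<theta>s" and "xs \<in> cells (hom_ocat \<theta>s i j)"
    using assms by (auto simp: c bracket_cells)
  then have xs: "length xs = j - i" "\<And>p. p < j - i \<Longrightarrow> xs ! p \<in> cells (\<theta>s ! (i + p))"
    by (auto simp: hom_ocat_nth)
  have x: "theta_cell (xs ! p) \<in> cells (nu (theta_adc (Ss ! (i + p))))" if "p < j - i" for p
    using factor_cell xs(2)[OF that] that ij by simp
  show ?thesis
    unfolding c
  proof (rule theta_nu_cellI)
    fix n \<alpha>
    show "theta_cell (TCell i j xs) n \<alpha> \<in> pos_chains (theta_adc (bracket_basis Ss)) n"
    proof (cases n)
      case 0
      then show ?thesis using ij len by (auto intro!: theta_pos_chains_frag_of simp: bracket_basis_def)
    next
      case (Suc m)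
      show ?thesis
        unfolding Suc theta_cell_simps
      proof (rule pos_chains_sum, rule suspend_pos)
        fix p assume p: "p \<in> {..<length xs}"
        then show "theta_cell (xs ! p) m \<alpha> \<in> pos_chains (theta_adc (Ss ! (i + p))) m"
          using theta_nu_cellD(1)[OF x] xs by simp
        show "i + p < length Ss" using p xs ij len by simp
        then show "[] \<notin> Ss ! (i + p)" using factor_closed by (simp add: closed_basis_def)
      qed
    qed
  next
    have "\<forall>p. \<exists>N. p < j - i \<longrightarrow> (\<forall>n\<ge>N. \<forall>\<alpha>. theta_cell (xs ! p) n \<alpha> = 0)"
      using theta_nu_cellD(2)[OF x] by blast
    then obtain N where N: "\<And>p n \<alpha>. p < j - i \<Longrightarrow> n \<ge> N p \<Longrightarrow> theta_cell (xs ! p) n \<alpha> = 0" by metis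
    let ?M = "Suc (\<Sum>p<j - i. N p)"
    have "theta_cell (TCell i j xs) n \<alpha> = 0" if n: "n \<ge> ?M" for n \<alpha>
    proof -
      obtain m where m: "n = Suc m" using n by (cases n) auto
      have "N p \<le> m" if "p < j - i" for p
        using member_le_sum[of p "{..<j - i}" N] that n m by simp
      then show ?thesis using N by (simp add: m xs)
    qed
    then show "\<exists>N. \<forall>n\<ge>N. \<forall>\<alpha>. theta_cell (TCell i j xs) n \<alpha> = 0" by blast
  next
    fix \<alpha>
    show "chain_sum tree_aug (theta_cell (TCell i j xs) 0 \<alpha>) = 1" by (simp add: tree_aug_def)
  next
    fix n \<alpha>
    have bd: "frag_extend tree_bd (theta_cell (TCell i j xs) (Suc n) \<alpha>) =
      (\<Sum>p<j - i. suspend (i + p) (frag_extend tree_bd (theta_cell (xs ! p) n \<alpha>))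
        + frag_cmul (chain_sum tree_aug (theta_cell (xs ! p) n \<alpha>)) (frag_of [Suc (i + p)] - frag_of [i + p]))"
      by (simp only: theta_cell_simps xs frag_extend_sum finite_lessThan o_def tree_bd_suspend)
    show "frag_extend tree_bd (theta_cell (TCell i j xs) (Suc n) \<alpha>) =
        theta_cell (TCell i j xs) n True - theta_cell (TCell i j xs) n False"
    proof (cases n)
      case 0
      \<comment> \<open>Each entry of the tuple has augmentation 1 in degree 0, so it contributes
        exactly one edge of the line, and the boundaries telescope.\<close>
      have "frag_extend tree_bd (theta_cell (TCell i j xs) (Suc n) \<alpha>) =
          (\<Sum>p<j - i. frag_of [i + Suc p] - frag_of [i + p])"
        unfolding bd
        by (rule sum.cong) (simp_all add: 0 theta_bd_degree_0[OF theta_nu_cellD(1)[OF x]] theta_nu_cellD(3)[OF x])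
      also have "\<dots> = frag_of [j] - frag_of [i]"
        using ij by (subst sum_lessThan_telescope) simp
      finally show ?thesis by (simp add: 0)
    next
      case (Suc m)
      have "frag_extend tree_bd (theta_cell (TCell i j xs) (Suc n) \<alpha>) =
          (\<Sum>p<j - i. suspend (i + p) (theta_cell (xs ! p) m True - theta_cell (xs ! p) m False))"
        unfolding bd
        by (rule sum.cong)
          (simp_all add: Suc theta_nu_cellD(4)[OF x] theta_aug_pos_degree[OF theta_nu_cellD(1)[OF x]])
      then show ?thesis by (simp add: Suc xs frag_extend_diff sum_subtractf)
    qed
  qed
qed

lemma bracket_theta_functor: "strict_functor (bracket \<theta>s) (nu (theta_adc (bracket_basis Ss))) theta_cell"
proof -
  let ?N = "nu (theta_adc (bracket_basis Ss))"
  have F: "theta_cell (src (\<theta>s ! p) n x) = nu_trunc False n (theta_cell x)"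
    "theta_cell (tgt (\<theta>s ! p) n x) = nu_trunc True n (theta_cell x)"
    "y \<in> cells (\<theta>s ! p) \<Longrightarrow> tgt (\<theta>s ! p) n x = src (\<theta>s ! p) n y \<Longrightarrow>
      theta_cell (ocomp (\<theta>s ! p) n x y) = (\<lambda>i \<alpha>. theta_cell x i \<alpha> - nu_trunc True n (theta_cell x) i \<alpha> + theta_cell y i \<alpha>)"
    if "p < length \<theta>s" "x \<in> cells (\<theta>s ! p)" for p n x y
    using factor_functor[OF that(1)] that(2) by (simp_all add: strict_functor_def nu_src_tgt) (simp add: nu_def)
  have st: "theta_cell (src (bracket \<theta>s) n c) = nu_trunc False n (theta_cell c)"
    "theta_cell (tgt (bracket \<theta>s) n c) = nu_trunc True n (theta_cell c)"
    if c: "c \<in> cells (bracket \<theta>s)" for n c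
  proof -
    obtain i j xs where cd: "c = TCell i j xs" by (cases c)
    have ij: "i \<le> j" "j \<le> length \<theta>s" and "xs \<in> cells (hom_ocat \<theta>s i j)"
      using c by (auto simp: cd bracket_cells)
    then have xs: "length xs = j - i" "\<And>p. p < j - i \<Longrightarrow> xs ! p \<in> cells (\<theta>s ! (i + p))"
      by (auto simp: hom_ocat_nth)
    have *: "theta_cell (src (bracket \<theta>s) n c) l \<alpha> = nu_trunc False n (theta_cell c) l \<alpha>
      \<and> theta_cell (tgt (bracket \<theta>s) n c) l \<alpha> = nu_trunc True n (theta_cell c) l \<alpha>" for l \<alpha>
    proof (cases n; cases l)
      fix m l' assume nl: "n = Suc m" "l = Suc l'"
      have "theta_cell (src (hom_ocat \<theta>s i j) m xs ! p) l' \<alpha> = nu_trunc False m (theta_cell (xs ! p)) l' \<alpha>"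
        "theta_cell (tgt (hom_ocat \<theta>s i j) m xs ! p) l' \<alpha> = nu_trunc True m (theta_cell (xs ! p)) l' \<alpha>" if "p < j - i" for p
        using that ij xs by (simp_all add: hom_ocat_nth F)
      then show ?thesis using ij xs by (simp add: nl cd hom_ocat_nth) (simp add: nu_trunc_def)
    qed (auto simp: cd nu_trunc_def)
    show "theta_cell (src (bracket \<theta>s) n c) = nu_trunc False n (theta_cell c)"
      "theta_cell (tgt (bracket \<theta>s) n c) = nu_trunc True n (theta_cell c)"
      using * by (auto simp: fun_eq_iff)
  qed
  have comp: "theta_cell (ocomp (bracket \<theta>s) n c d) = ocomp ?N n (theta_cell c) (theta_cell d)"
    if c: "c \<in> cells (bracket \<theta>s)" and d: "d \<in> cells (bracket \<theta>s)"
      and cd: "tgt (bracket \<theta>s) n c = src (bracket \<theta>s) n d" for n c d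
  proof -
    obtain i j xs where c': "c = TCell i j xs" by (cases c)
    obtain i' j' ys where d': "d = TCell i' j' ys" by (cases d)
    have ij: "i \<le> j" "j \<le> length \<theta>s" "i' \<le> j'" "j' \<le> length \<theta>s"
      and "xs \<in> cells (hom_ocat \<theta>s i j)" "ys \<in> cells (hom_ocat \<theta>s i' j')"
      using c d by (auto simp: c' d' bracket_cells)
    then have xs: "length xs = j - i" "\<And>p. p < j - i \<Longrightarrow> xs ! p \<in> cells (\<theta>s ! (i + p))"
      and ys: "length ys = j' - i'" "\<And>p. p < j' - i' \<Longrightarrow> ys ! p \<in> cells (\<theta>s ! (i' + p))"
      by (auto simp: hom_ocat_nth)
    have N: "ocomp ?N n u v l \<alpha> = u l \<alpha> - nu_trunc True n u l \<alpha> + v l \<alpha>" for u v l \<alpha>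
      by (simp add: nu_def)
    have "theta_cell (ocomp (bracket \<theta>s) n c d) l \<alpha> = ocomp ?N n (theta_cell c) (theta_cell d) l \<alpha>" for l \<alpha>
      unfolding N
    proof (cases n)
      case 0
      then have j: "i' = j" using cd by (simp add: c' d')
      show "theta_cell (ocomp (bracket \<theta>s) n c d) l \<alpha> =
        theta_cell c l \<alpha> - nu_trunc True n (theta_cell c) l \<alpha> + theta_cell d l \<alpha>"
      proof (cases l)
        case (Suc l')
        \<comment> \<open>Composition along an object concatenates tuples; the second tuple starts
          at factor \<open>i + length xs\<close>, which is \<open>j\<close>.\<close>
        have "(\<Sum>p<length (xs @ ys). suspend (i + p) (theta_cell ((xs @ ys) ! p) l' \<alpha>)) =
            (\<Sum>p<length xs. suspend (i + p) (theta_cell (xs ! p) l' \<alpha>))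
            + (\<Sum>p<length ys. suspend (i + (length xs + p)) (theta_cell (ys ! p) l' \<alpha>))"
          by (simp add: sum_lessThan_add nth_append)
        then show ?thesis using xs ij by (simp add: 0 Suc c' d' j nu_trunc_def)
      qed (auto simp: 0 c' d' j nu_trunc_def)
    next
      case (Suc m)
      then have j: "i' = i" "j' = j" and h: "tgt (hom_ocat \<theta>s i j) m xs = src (hom_ocat \<theta>s i j) m ys"
        using cd by (auto simp: c' d')
      have eq: "tgt (\<theta>s ! (i + p)) m (xs ! p) = src (\<theta>s ! (i + p)) m (ys ! p)" if "p < j - i" for p
        using arg_cong[OF h, of "\<lambda>zs. zs ! p"] that xs ys ij j by (simp add: hom_ocat_nth)
      show "theta_cell (ocomp (bracket \<theta>s) n c d) l \<alpha> =
        theta_cell c l \<alpha> - nu_trunc True n (theta_cell c) l \<alpha> + theta_cell d l \<alpha>"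
      proof (cases l)
        case l: (Suc l')
        have "theta_cell (ocomp (hom_ocat \<theta>s i j) m xs ys ! p) l' \<alpha> = theta_cell (xs ! p) l' \<alpha>
          - nu_trunc True m (theta_cell (xs ! p)) l' \<alpha> + theta_cell (ys ! p) l' \<alpha>" if "p < j - i" for p
          using that ij xs ys eq[OF that] by (simp add: hom_ocat_nth F j)
        then have "theta_cell (ocomp (bracket \<theta>s) n c d) l \<alpha> =
          (\<Sum>p<j - i. suspend (i + p) (theta_cell (xs ! p) l' \<alpha>
            - nu_trunc True m (theta_cell (xs ! p)) l' \<alpha> + theta_cell (ys ! p) l' \<alpha>))"
          using ij xs ys by (simp add: Suc l c' d' j hom_ocat_nth)
        also have "\<dots> = theta_cell c l \<alpha> - nu_trunc True n (theta_cell c) l \<alpha> + theta_cell d l \<alpha>"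
          using xs ys by (simp add: Suc l c' d' j frag_extend_add frag_extend_diff sum.distrib sum_subtractf)
            (simp add: nu_trunc_def)
        finally show ?thesis .
      qed (auto simp: Suc c' d' j nu_trunc_def)
    qed
    then show ?thesis by blast
  qed
  show ?thesis
    unfolding strict_functor_def nu_src_tgt
    using bracket_theta_cell st comp nu_strict bracket_strict[OF factor_strict] by blast
qed

text \<open>The end points are seen in degree 0, and each entry is recovered as a component of the
  chains in positive degree.\<close>

lemma bracket_theta_inj: "inj_on theta_cell (cells (bracket \<theta>s))"
proof (rule inj_onI)
  fix c d assume c: "c \<in> cells (bracket \<theta>s)" and d: "d \<in> cells (bracket \<theta>s)" and eq: "theta_cell c = theta_cell d"
  obtain i j xs where c': "c = TCell i j xs" by (cases c)
  obtain i' j' ys where d': "d = TCell i' j' ys" by (cases d)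
  have j: "i' = i" "j' = j"
    using fun_cong[OF fun_cong[OF eq, of 0], of False] fun_cong[OF fun_cong[OF eq, of 0], of True]
    by (simp_all add: c' d' frag_of_eq)
  have ij: "i \<le> j" "j \<le> length \<theta>s" and "xs \<in> cells (hom_ocat \<theta>s i j)" "ys \<in> cells (hom_ocat \<theta>s i j)"
    using c d by (auto simp: c' d' j bracket_cells)
  then have xs: "length xs = j - i" "\<And>p. p < j - i \<Longrightarrow> xs ! p \<in> cells (\<theta>s ! (i + p))"
    and ys: "length ys = j - i" "\<And>p. p < j - i \<Longrightarrow> ys ! p \<in> cells (\<theta>s ! (i + p))"
    by (auto simp: hom_ocat_nth)
  have "xs = ys"
  proof (rule nth_equalityI)
    show "length xs = length ys" using xs ys by simp
    fix p assume "p < length xs"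
    then have p: "p < j - i" using xs by simp
    have "theta_cell (xs ! p) l \<alpha> = theta_cell (ys ! p) l \<alpha>" for l \<alpha>
    proof -
      have "component (i + p) (theta_cell c (Suc l) \<alpha>) = component (i + p) (theta_cell d (Suc l) \<alpha>)"
        by (simp add: eq)
      then show ?thesis using p xs(1) ys(1) by (simp add: c' d' j component_sum_suspend)
    qed
    then have "theta_cell (xs ! p) = theta_cell (ys ! p)" by blast
    moreover have "inj_on theta_cell (cells (\<theta>s ! (i + p)))"
      using models[of "i + p"] p ij by (auto simp: models_def bij_betw_def)
    ultimately show "xs ! p = ys ! p" using xs(2)[OF p] ys(2)[OF p] by (auto dest: inj_onD)
  qed
  then show "c = d" by (simp add: c' d' j)
qed

text \<open>The two chains in degree 0 are objects \<open>i\<close> and \<open>j\<close>. The chains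
  in degree 1 form a path between them, which fixes the augmentation of every component: 1 on the
  factors between \<open>i\<close> and \<open>j\<close>, and 0 elsewhere.\<close>

lemma bracket_theta_surj:
  assumes x: "x \<in> cells (nu (theta_adc (bracket_basis Ss)))"
  shows "\<exists>c \<in> cells (bracket \<theta>s). theta_cell c = x"
proof -
  note xD = theta_nu_cellD[OF x]
  have nil: "[] \<notin> bracket_basis Ss" by (simp add: bracket_basis_def)
  obtain i where i: "[i] \<in> bracket_basis Ss" "x 0 False = frag_of [i]"
    using theta_aug_1_imp_frag_of[OF xD(1) nil xD(3)] by blast
  obtain j where j: "[j] \<in> bracket_basis Ss" "x 0 True = frag_of [j]"
    using theta_aug_1_imp_frag_of[OF xD(1) nil xD(3)] by blast
  have "[] \<notin> Ss ! p" if "p < length Ss" for p using factor_closed[OF that] by (simp add: closed_basis_def)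
  then have le: "i \<le> length \<theta>s" "j \<le> length \<theta>s" using i j len by (auto simp: bracket_basis_def)
  define y where "y p = (\<lambda>n \<alpha>. component p (x (Suc n) \<alpha>))" for p
  have y_pos: "y p n \<alpha> \<in> pos_chains (theta_adc (Ss ! p)) n" if "p < length \<theta>s" for p n \<alpha>
    unfolding y_def using component_pos[OF xD(1)] that len by simp
  have y_aug: "chain_sum tree_aug (y p 0 \<alpha>) = of_bool (i \<le> p) - of_bool (j \<le> p)" if "p < length \<theta>s" for p \<alpha>
  proof -
    have "(\<Sum>p<length Ss. frag_cmul (chain_sum tree_aug (y p 0 \<alpha>)) (frag_of [Suc p] - frag_of [p])) =
        frag_of [j] - frag_of [i]"
      using bracket_bd_1[OF factor_closed xD(1)] xD(4)[of 0 \<alpha>] i j by (simp add: y_def)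
    from telescope_unique[OF this] show ?thesis using that len by simp
  qed
  have y_bd: "frag_extend tree_bd (y p (Suc n) \<alpha>) = y p n True - y p n False" if "p < length \<theta>s" for p n \<alpha>
    using component_bd[OF factor_closed xD(1), of p] that len xD(4) by (simp add: y_def)
  \<comment> \<open>A path running backwards would have augmentation -1 at factor \<open>j\<close>,
    against positivity.\<close>
  have ij: "i \<le> j"
  proof (rule ccontr)
    assume "\<not> i \<le> j"
    then have "j < length \<theta>s" "\<not> i \<le> j" using le by auto
    then show False using y_aug[of j True] theta_aug_nonneg[OF y_pos[of j 0 True]] by simp
  qed
  \<comment> \<open>By induction on the degree: augmentation 0 gives the start, and once one degree
    vanishes the next consists of positive cycles.\<close>
  have y_zero: "y p n \<alpha> = 0" if p: "p < length \<theta>s" "\<not> (i \<le> p \<and> p < j)" for p n \<alpha>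
  proof (induction n arbitrary: \<alpha>)
    case 0
    have "chain_sum tree_aug (y p 0 \<alpha>) = 0" using y_aug[OF p(1)] p(2) ij by auto
    then show ?case
      using y_pos[OF p(1)] factor_closed[of p] p(1) len
      by (intro theta_aug_0_imp_0[of _ "Ss ! p"]) (auto simp: closed_basis_def)
  next
    case (Suc n)
    then have "frag_extend tree_bd (y p (Suc n) \<alpha>) = 0" using y_bd[OF p(1)] by simp
    then show ?case
      using y_pos[OF p(1)] models[OF p(1)] by (auto simp: models_def acyclic_basis_def)
  qed
  have y_cell: "y p \<in> cells (nu (theta_adc (Ss ! p)))" if p: "i \<le> p" "p < j" for p
  proof (rule theta_nu_cellI)
    have "p < length \<theta>s" using p le by simp
    then show "y p n \<alpha> \<in> pos_chains (theta_adc (Ss ! p)) n" "chain_sum tree_aug (y p 0 \<alpha>) = 1"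
      "frag_extend tree_bd (y p (Suc n) \<alpha>) = y p n True - y p n False" for n \<alpha>
      using p y_pos y_aug y_bd by simp_all
    obtain N where "\<forall>n\<ge>N. \<forall>\<alpha>. x n \<alpha> = 0" using xD(2) by blast
    then have "\<forall>n\<ge>N. \<forall>\<alpha>. y p n \<alpha> = 0" by (simp add: y_def)
    then show "\<exists>N. \<forall>n\<ge>N. \<forall>\<alpha>. y p n \<alpha> = 0" ..
  qed
  have "\<exists>z \<in> cells (\<theta>s ! p). theta_cell z = y p" if p: "i \<le> p" "p < j" for p
  proof -
    have "y p \<in> theta_cell ` cells (\<theta>s ! p)"
      using models[of p] y_cell[OF p] p le by (simp add: models_def bij_betw_def)
    then show ?thesis by force
  qed
  then obtain z where z: "\<And>p. i \<le> p \<Longrightarrow> p < j \<Longrightarrow> z p \<in> cells (\<theta>s ! p)"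
    "\<And>p. i \<le> p \<Longrightarrow> p < j \<Longrightarrow> theta_cell (z p) = y p" by metis
  define xs where "xs = map (\<lambda>p. z (i + p)) [0..<j - i]"
  have "TCell i j xs \<in> cells (bracket \<theta>s)"
    using z(1) le ij by (auto simp: bracket_cells hom_ocat_nth xs_def)
  moreover have "theta_cell (TCell i j xs) = x"
  proof (intro ext)
    fix n \<alpha>
    show "theta_cell (TCell i j xs) n \<alpha> = x n \<alpha>"
    proof (cases n)
      case 0
      then show ?thesis using i j by (cases \<alpha>) auto
    next
      case (Suc m)
      have "theta_cell (TCell i j xs) n \<alpha> = (\<Sum>p<j - i. suspend (i + p) (y (i + p) m \<alpha>))"
        using z(2) by (simp add: Suc xs_def)
      also have "\<dots> = (\<Sum>p\<in>{i..<j}. suspend p (y p m \<alpha>))"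
        using ij by (intro sum.reindex_bij_witness[of _ "\<lambda>p. p - i" "\<lambda>p. i + p"]) auto
      also have "\<dots> = (\<Sum>p<length Ss. suspend p (y p m \<alpha>))"
        using le len y_zero by (intro sum.mono_neutral_left) auto
      also have "\<dots> = x n \<alpha>"
        using suspend_decomposition[OF xD(1)[of "Suc m" \<alpha>]] by (simp add: Suc y_def)
      finally show ?thesis .
    qed
  qed
  ultimately show ?thesis by blast
qed

lemma models_bracket: "models (bracket \<theta>s) (bracket_basis Ss)"
proof -
  have "closed_basis (bracket_basis Ss)"
    using factor_closed by (intro closed_bracket_basis) (auto simp: in_set_conv_nth)
  moreover have "acyclic_basis (bracket_basis Ss)"
    using models len by (intro acyclic_bracket_basis factor_closed) (simp_all add: models_def)
  moreover have "bij_betw theta_cell (cells (bracket \<theta>s)) (cells (nu (theta_adc (bracket_basis Ss))))"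
    unfolding bij_betw_def using bracket_theta_inj bracket_theta_cell bracket_theta_surj by fast
  ultimately show ?thesis using bracket_theta_functor by (simp add: models_def)
qed

end

section \<open>Objects of Theta as retracts of cubes\<close>

text \<open>End points are forgotten, as a factor enters the next level only through its
  suspension.\<close>

definition cube_retract :: "nat list set \<Rightarrow> bool" where
  "cube_retract S \<longleftrightarrow> (\<exists>n f g. adc_retract (theta_adc S) (cube_adc n) f g)"

text \<open>Factors are appended on the right. Control of the end points is carried along because
  the next suspension is attached at the image of the last object.\<close>

lemma bracket_adc_retract:
  assumes "\<And>S. S \<in> set Ss \<Longrightarrow> closed_basis S \<and> cube_retract S"
  shows "\<exists>N f g. adc_retract (theta_adc (bracket_basis Ss)) (cube_adc N) f g \<and>
    f [0] = frag_of (replicate N I0) \<and> f [length Ss] = frag_of (replicate N I1)"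
  using assms
proof (induction Ss rule: rev_induct)
  case Nil
  have 0: "bracket_basis [] = {[0]}" by (auto simp: bracket_basis_def)
  have "adc_map (theta_adc {[0]}) (cube_adc 0) (\<lambda>_. frag_of [])"
    unfolding adc_map_to_cube by (simp add: tree_aug_def cube_word_pos del: cube_adc.simps)
  moreover have "adc_map (cube_adc 0) (theta_adc {[0]}) (\<lambda>_. frag_of [0])"
    unfolding adc_map_from_cube by (simp add: tree_aug_def theta_pos_chains_frag_of del: cube_adc.simps)
  ultimately have "adc_retract (theta_adc (bracket_basis [])) (cube_adc 0) (\<lambda>_. frag_of []) (\<lambda>_. frag_of [0])"
    unfolding adc_retract_def 0 by simp
  then show ?case unfolding list.size by (metis replicate_0)
next
  case (snoc S Ss)
  have S: "closed_basis S" "cube_retract S"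
    and Ss: "\<And>S. S \<in> set Ss \<Longrightarrow> closed_basis S \<and> cube_retract S"
    using snoc.prems by simp_all
  obtain N f g where fg: "adc_retract (theta_adc (bracket_basis Ss)) (cube_adc N) f g"
    "f [0] = frag_of (replicate N I0)" "f [length Ss] = frag_of (replicate N I1)"
    using snoc.IH[OF Ss] by blast
  obtain n f' g' where fg': "adc_retract (theta_adc S) (cube_adc n) f' g'" using S(2) unfolding cube_retract_def by blast
  interpret snoc_retract "bracket_basis Ss" S "length Ss" N n f g f' g'
  proof
    show "closed_basis (bracket_basis Ss)" using Ss by (simp add: closed_bracket_basis)
    show "closed_basis S" by (fact S)
    show "[0] \<in> bracket_basis Ss" "[length Ss] \<in> bracket_basis Ss" by (simp_all add: bracket_basis_def)
    show "(\<exists>i\<le>length Ss. b = [i]) \<or> (\<exists>p<length Ss. \<exists>c. b = p # c)" if "b \<in> bracket_basis Ss" for b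
      using that by (auto simp: bracket_basis_def)
  qed (fact fg fg')+
  show ?case
    unfolding bracket_basis_snoc length_append_singleton using retract_snoc F_ends by (intro exI conjI)
qed

lemma Theta_std_models:
  "\<theta> \<in> Theta_std \<Longrightarrow> \<exists>S. models \<theta> S \<and> cube_retract S"
proof (induction rule: Theta_std.induct)
  case (1 \<theta>s)
  then obtain B where B: "\<And>\<theta>. \<theta> \<in> set \<theta>s \<Longrightarrow>
      models \<theta> (B \<theta>) \<and> cube_retract (B \<theta>)"
    by metis
  have "models (bracket \<theta>s) (bracket_basis (map B \<theta>s))"
    by (rule models_bracket) (simp_all add: B)
  moreover have "closed_basis S \<and> cube_retract S"
    if "S \<in> set (map B \<theta>s)" for S
    using that B by (auto simp: models_def)
  then have "cube_retract (bracket_basis (map B \<theta>s))"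
    using bracket_adc_retract unfolding cube_retract_def[of "bracket_basis (map B \<theta>s)"] by blast
  ultimately show ?case by blast
qed

text \<open>The isomorphism with \<nu> of the complex is composed with the image under \<nu> of the
  retract of complexes.\<close>

lemma bp_bracket_retract:
  assumes "set \<theta>s \<subseteq> Theta_std" shows "\<exists>N. bp_retract (bp_bracket \<theta>s) (bp_cube N)"
proof -
  have "\<forall>\<theta>\<in>set \<theta>s. \<exists>S. models \<theta> S \<and> cube_retract S" using Theta_std_models assms by blast
  then obtain B where B: "\<And>\<theta>. \<theta> \<in> set \<theta>s \<Longrightarrow> models \<theta> (B \<theta>) \<and> cube_retract (B \<theta>)" by metis
  let ?K = "theta_adc (bracket_basis (map B \<theta>s))" and ?C = "cells (bracket \<theta>s)"
  have m: "strict_functor (bracket \<theta>s) (nu ?K) theta_cell" "bij_betw theta_cell ?C (cells (nu ?K))"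
    using models_bracket[of "map B \<theta>s" \<theta>s] B by (simp_all add: models_def)
  have "closed_basis S \<and> cube_retract S"
    if "S \<in> set (map B \<theta>s)" for S
    using that B by (auto simp: models_def)
  then have "\<exists>N f g. adc_retract ?K (cube_adc N) f g \<and>
      f [0] = frag_of (replicate N I0) \<and> f [length (map B \<theta>s)] = frag_of (replicate N I1)"
    by (rule bracket_adc_retract)
  then obtain N f g where fg: "adc_retract ?K (cube_adc N) f g"
    and ends: "f [0] = frag_of (replicate N I0)" "f [length \<theta>s] = frag_of (replicate N I1)"
    unfolding length_map by blast
  let ?i = "nu_map f \<circ> theta_cell" and ?r = "the_inv_into ?C theta_cell \<circ> nu_map g"
  have i: "strict_functor (bracket \<theta>s) (cube N) ?i" and r: "strict_functor (cube N) (bracket \<theta>s) ?r"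
    unfolding cube_def using fg m
    by (auto intro!: strict_functor_compose nu_map_functor strict_functor_inverse simp: adc_retract_def)
  have ri: "?r (?i x) = x" if "x \<in> ?C" for x
  proof -
    have "theta_cell x \<in> cells (nu ?K)" using m(1) that by (simp add: strict_functor_def)
    then show ?thesis
      using nu_map_retract[OF fg] the_inv_into_f_f[OF bij_betw_imp_inj_on[OF m(2)] that] by simp
  qed
  have i_pt: "?i (TCell j j []) = cube_vertex v" if "f [j] = frag_of v" for j v
  proof (intro ext)
    fix n \<alpha> show "?i (TCell j j []) n \<alpha> = cube_vertex v n \<alpha>"
      using that by (cases n) (simp_all add: nu_map_def cube_vertex_def)
  qed
  have pt: "?i (TCell 0 0 []) = cube_vertex (replicate N I0)"
    "?i (TCell (length \<theta>s) (length \<theta>s) []) = cube_vertex (replicate N I1)"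
    using i_pt ends by blast+
  have "TCell 0 0 [] \<in> ?C" "TCell (length \<theta>s) (length \<theta>s) [] \<in> ?C" by (simp_all add: bracket_cells)
  \<comment> \<open>The retraction preserves the base points because the inclusion does and the
    retraction is its left inverse.\<close>
  from this[THEN ri] have "?r (cube_vertex (replicate N I0)) = TCell 0 0 []"
    "?r (cube_vertex (replicate N I1)) = TCell (length \<theta>s) (length \<theta>s) []"
    unfolding pt by blast+
  then have "bp_functor (bp_bracket \<theta>s) (bp_cube N) ?i" "bp_functor (bp_cube N) (bp_bracket \<theta>s) ?r"
    using bipointed_bp_bracket[OF assms] bipointed_bp_cube[of N] i r pt
    by (simp_all add: bp_functor_def bp_bracket_def bp_cube_def)
  moreover have "\<forall>x \<in> cells (fst (bp_bracket \<theta>s)). ?r (?i x) = x" using ri by (simp add: bp_bracket_def)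
  ultimately show ?thesis unfolding bp_retract_def by blast
qed

theorem corollary3p4:
  shows "(Theta_nat :: 'a bp_ocat set) \<subseteq> bp_idem_completion (range bp_cube)
       \<and> (Theta :: 'a ocat set) \<subseteq> idem_completion (range cube)"
proof (intro conjI subsetI)
  fix P :: "'a bp_ocat" assume "P \<in> Theta_nat"
  then obtain \<theta>s where "set \<theta>s \<subseteq> Theta_std" and P: "bp_iso P (bp_bracket \<theta>s)" by (auto simp: Theta_nat_def)
  then obtain N where "bp_retract (bp_bracket \<theta>s) (bp_cube N)" using bp_bracket_retract by blast
  with bp_iso_retract[OF P] have "bp_retract P (bp_cube N)" by (rule bp_retract_trans)
  then show "P \<in> bp_idem_completion (range bp_cube)" by (auto simp: bp_idem_completion_def)
next
  fix C :: "'a ocat" assume "C \<in> Theta"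
  then obtain \<theta> where "\<theta> \<in> Theta_std" and C: "ocat_iso C \<theta>" by (auto simp: Theta_def)
  then obtain \<theta>s where \<theta>: "\<theta> = bracket \<theta>s" "set \<theta>s \<subseteq> Theta_std" by (auto elim: Theta_std.cases)
  then obtain N where "bp_retract (bp_bracket \<theta>s) (bp_cube N)" using bp_bracket_retract by blast
  \<comment> \<open>Every standard object is a bracket and so carries a natural bipointing;
    forgetting it leaves a retract of the bare cube.\<close>
  from bp_retract_ocat_retract[OF this] have "ocat_retract \<theta> (cube N)"
    by (simp add: \<theta> bp_bracket_def bp_cube_def)
  with ocat_iso_retract[OF C] have "ocat_retract C (cube N)" by (rule ocat_retract_trans)
  then show "C \<in> idem_completion (range cube)" by (auto simp: idem_completion_def)
qed

end
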